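(* Let $k\ge 2$ and $\ell\ge 3$ be integers and let $\varepsilon>0$. Then, uniformly for real $x\ge 1$ and positive integers $H$, $$\mathfrak{M}(x,H,\ell)\ll_{\varepsilon,k,\ell} x^{\varepsilon}\left(H^{\frac{\ell}{2k}}x+H^{\ell}x^{\frac{2}{k+1}}\right).$$ In particular, with $c_k=\frac{2k(k-1)}{(k+1)(2k-1)}$, for $1\le H\le x^{c_k/\ell}$ one has $$\mathfrak{M}(x,H,\ell)\ll_{\varepsilon,k,\ell} x^{1+\varepsilon}H^{\frac{\ell}{2k}}.$$
   Context: For an integer $k\ge 2$, a positive integer $n$ is $k$-free if it is not divisible by the $k$-th power of any integer $>1$; $\mu_k$ denotes the characteristic function of the $k$-free positive integers, and $\zeta$ is the Riemann zeta function. For positive integers $n,H$ let $N(n,H)=\sum_{0\le h<H}\mu_k(n+h)$ and $D(n,H)=N(n,H)-\zeta(k)^{-1}H$. For $\ell\ge1$ define $\mathfrak{M}(x,H,\ell)=\sum_{0<n\le x}D(n,H)^{\ell}$. The notation $A\ll_{\varepsilon,k,\ell}B$ means $|A|\le CB$ with a constant $C$ depending only on $\varepsilon,k,\ell$. *)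

theory Defs
  imports "HOL-Analysis.Analysis"
begin

definition k_free :: "nat \<Rightarrow> nat \<Rightarrow> bool" where
  "k_free k n \<longleftrightarrow> n > 0 \<and> \<not> (\<exists>d>1. d ^ k dvd n)"

definition mu_free :: "nat \<Rightarrow> nat \<Rightarrow> real" where
  "mu_free k n = (if k_free k n then 1 else 0)"

(* The Riemann zeta function at integers k > 1, by its (there absolutely convergent) Dirichlet series. *)
definition zeta_at :: "nat \<Rightarrow> real" where
  "zeta_at k = (\<Sum>n. 1 / real (Suc n) ^ k)"

definition N_free :: "nat \<Rightarrow> nat \<Rightarrow> nat \<Rightarrow> real" where
  "N_free k n H = (\<Sum>h<H. mu_free k (n + h))"

definition D_free :: "nat \<Rightarrow> nat \<Rightarrow> nat \<Rightarrow> real" where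
  "D_free k n H = N_free k n H - inverse (zeta_at k) * real H"

definition moment :: "nat \<Rightarrow> real \<Rightarrow> nat \<Rightarrow> nat \<Rightarrow> real" where
  "moment k x H l = (\<Sum>n | 0 < n \<and> real n \<le> x. D_free k n H ^ l)"

definition c_exp :: "nat \<Rightarrow> real" where
  "c_exp k = 2 * real k * (real k - 1) / ((real k + 1) * (2 * real k - 1))"

end

theory Submission
  imports Defs "HOL-Number_Theory.Cong"
begin

text \<open>
  Restrict the sieve to a finite set \<open>P\<close> of primes. Writing the indicator of \<open>p\<^sup>k dvd m\<close> as its
  mean \<open>1 / p\<^sup>k\<close> plus a fluctuation of mean zero turns \<open>D(n,H)\<close> into a combination, with coefficients
  of modulus at most 1, of functions \<open>g\<^sub>S\<close> (\<open>gdev\<close> below) indexed by the nonempty \<open>S \<subseteq> P\<close>;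
  expanding the \<open>l\<close>-th power gives a sum over tuples \<open>(S\<^sub>1, \<dots>, S\<^sub>l)\<close>.
  Let \<open>U\<close> be the union of the tuple, \<open>r\<close> the product of the primes in \<open>U\<close>, and \<open>y = x\<^bsup>1/(k+1)\<^esup>\<close>.

  If \<open>r \<le> y\<^sup>2\<close>, the sum over \<open>n \<le> x\<close> is \<open>x\<close> times the mean over a full period, up to \<open>O(H\<^sup>l)\<close>.
  The mean vanishes unless every prime of \<open>U\<close> lies in at least two of the \<open>S\<^sub>i\<close>. Otherwise it is
  bounded by averaging out one factor after the other: if \<open>W\<close> is the union of the other sets still
  present and \<open>a = \<Prod>(S \<inter> W)\<close>, the average of \<open>\<bar>g\<^sub>S\<bar>\<close> over a residue class modulo \<open>a\<^sup>k\<close> is, up to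
  a factor \<open>2\<^bsup>|S|\<^esup>\<close>, at most \<open>min 1 ((H + a\<^sup>k) / (\<Prod>S)\<^sup>k)\<close>. Doing this in the
  given and in the reversed order and taking the geometric mean yields \<open>H\<^bsup>l/2k\<^esup> / r\<close>, which is
  summable over the tuples up to a factor \<open>x\<^bsup>\<epsilon>\<^esup>\<close>.

  If \<open>r > y\<^sup>2\<close>, absolute values suffice: either the mean parts contribute primes with product
  above \<open>y\<close>, and Rankin's trick applies, or the divisibility conditions do, and then some
  subtuple of conditions already has modulus (without the exponent \<open>k\<close>) in \<open>(y, y\<^sup>2]\<close> or
  a single one exceeds \<open>y\<close>; both are rare. This needs \<open>H \<le> x\<close>; for larger \<open>H\<close> the trivial
  bound \<open>D(n,H) = O(H\<^bsup>1/2+\<epsilon>\<^esup>)\<close> is enough.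
\<close>

section \<open>Residue classes and products of primes\<close>

lemma card_residue_class_block:
  fixes q r b :: nat
  assumes "r < q"
  shows "card {n \<in> {b..<b+q}. n mod q = r} = 1"
proof -
  have inj: "inj_on (\<lambda>n. n mod q) {b..<b+q}"
  proof (rule linorder_inj_onI')
    fix i j assume "i \<in> {b..<b+q}" "j \<in> {b..<b+q}" "i < j"
    then have "0 < j - i" "j - i < q" by auto
    then have "\<not> q dvd j - i" by (auto dest: dvd_imp_le)
    then show "i mod q \<noteq> j mod q"
      using \<open>i < j\<close> by (metis mod_eq_dvd_iff_nat less_imp_le)
  qed
  have "(\<lambda>n. n mod q) ` {b..<b+q} = {..<q}"
    using assms by (intro card_subset_eq) (auto simp: card_image[OF inj])
  then obtain n where n: "n \<in> {b..<b+q}" "n mod q = r"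
    using assms by (metis imageE lessThan_iff)
  have "{n \<in> {b..<b+q}. n mod q = r} = {n}"
    using n inj by (auto simp: inj_on_def)
  then show ?thesis by simp
qed

lemma card_residue_class_blocks:
  fixes q r b t :: nat
  assumes "r < q"
  shows "card {n \<in> {b..<b+q*t}. n mod q = r} = t"
proof (induction t)
  case (Suc t)
  have "{n \<in> {b..<b+q*Suc t}. n mod q = r} =
        {n \<in> {b..<b+q*t}. n mod q = r} \<union> {n \<in> {b+q*t..<b+q*t+q}. n mod q = r}" by auto
  then have "card {n \<in> {b..<b+q*Suc t}. n mod q = r} =
        card {n \<in> {b..<b+q*t}. n mod q = r} + card {n \<in> {b+q*t..<b+q*t+q}. n mod q = r}"
    by (simp add: card_Un_disjoint disjoint_iff)
  then show ?case using Suc card_residue_class_block[OF assms] by simp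
qed auto

text \<open>The length \<open>N\<close> lies between \<open>t = N div q\<close> and
  \<open>t + 1\<close> full blocks, each of which holds exactly one element of the class.\<close>

lemma card_residue_class_approx:
  fixes q r b N :: nat
  assumes "r < q"
  shows "\<bar>real (card {n \<in> {b..<b+N}. n mod q = r}) - real N / real q\<bar> \<le> 1"
proof -
  define t where "t = N div q"
  have N: "q * t \<le> N" "N < q * Suc t"
    using assms by (auto simp: t_def dividend_less_times_div)
  have "card {n \<in> {b..<b+q*t}. n mod q = r} \<le> card {n \<in> {b..<b+N}. n mod q = r}"
    using N by (intro card_mono) auto
  moreover have "card {n \<in> {b..<b+N}. n mod q = r} \<le> card {n \<in> {b..<b+q*Suc t}. n mod q = r}"
    using N by (intro card_mono) auto
  ultimately have "t \<le> card {n \<in> {b..<b+N}. n mod q = r}" "card {n \<in> {b..<b+N}. n mod q = r} \<le> Suc t"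
    unfolding card_residue_class_blocks[OF assms] by auto
  moreover have "real t \<le> real N / real q" "real N / real q \<le> real t + 1"
    using N assms by (simp_all add: field_simps flip: of_nat_mult of_nat_add)
  ultimately show ?thesis by linarith
qed

lemma card_linear_congruence:
  fixes q u m M :: nat
  assumes "coprime u q" "q dvd M" "M > 0"
  shows "real (card {t \<in> {..<M}. q dvd m + u * t}) = real M / real q"
proof -
  have q: "q > 0" using assms by (auto intro: Nat.gr0I)
  obtain v where v: "[u * v = 1] (mod q)" 
    using cong_solve_coprime_nat[OF assms(1)] by auto
  \<comment> \<open>In the naturals \<open>q * m - m\<close> stands for -m modulo \<open>q\<close>,
    so \<open>t0\<close> makes \<open>m + u * t0\<close> divisible by \<open>q\<close>.\<close>
  define t0 where "t0 = v * (q * m - m)"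
  have "[m + u * t0 = m + 1 * (q * m - m)] (mod q)"
    unfolding t0_def mult.assoc[symmetric] using v by (intro cong_add cong_mult) auto
  also have "m + 1 * (q * m - m) = q * m" using q by simp
  finally have t0: "q dvd m + u * t0" by (metis cong_dvd_iff dvd_triv_left)
  have iff: "q dvd m + u * t \<longleftrightarrow> t mod q = t0 mod q" for t
  proof -
    have "q dvd m + u * t \<longleftrightarrow> [m + u * t = m + u * t0] (mod q)"
      using t0 by (metis cong_0_iff cong_def dvd_imp_mod_0 mod_0_imp_dvd)
    also have "\<dots> \<longleftrightarrow> [t = t0] (mod q)"
      using assms(1) by (simp add: cong_add_lcancel_nat cong_mult_lcancel_nat)
    finally show ?thesis by (simp add: cong_def)
  qed
  obtain c where c: "M = q * c" using assms by blast
  show ?thesis using card_residue_class_blocks[of "t0 mod q" q 0 c] q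
    by (simp add: iff c atLeast0LessThan)
qed

lemma sum_periodic_shift:
  fixes F :: "nat \<Rightarrow> real"
  assumes "\<And>n. F (n + M) = F n"
  shows "(\<Sum>n<M. F (n + a)) = (\<Sum>n<M. F n)"
proof (induction a)
  case (Suc a)
  have "(\<Sum>n<M. F (n + Suc a)) = (\<Sum>n<Suc M. F (n + a)) - F a"
    by (subst sum.lessThan_Suc_shift) simp
  also have "\<dots> = (\<Sum>n<M. F (n + a))"
    using assms[of a] by (simp add: add.commute)
  finally show ?case using Suc by simp
qed simp

text \<open>Summing over a full period is invariant under the shift by \<open>u * t\<close>, which
  leaves \<open>A\<close> fixed; summing over \<open>t\<close> therefore replaces \<open>B\<close>
  by its sum along the progression with step \<open>u\<close>. This is how single factors are
  averaged out below.\<close>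

lemma sum_periodic_average:
  fixes A B :: "nat \<Rightarrow> real"
  assumes A: "\<And>n. A (n + u) = A n" and AM: "\<And>n. A (n + M) = A n" and BM: "\<And>n. B (n + M) = B n"
  shows "real M * (\<Sum>n<M. A n * B n) = (\<Sum>n<M. A n * (\<Sum>t<M. B (n + u * t)))"
proof -
  have Au: "A (n + u * t) = A n" for n t
  proof (induction t)
    case (Suc t) 
    have "A (n + u * Suc t) = A ((n + u * t) + u)" by (simp add: algebra_simps)
    then show ?case using A Suc by metis
  qed simp
  have "(\<Sum>n<M. A n * (\<Sum>t<M. B (n + u * t))) = (\<Sum>t<M. \<Sum>n<M. A (n + u * t) * B (n + u * t))"
    by (subst sum.swap) (simp add: Au sum_distrib_left)
  also have "\<dots> = (\<Sum>t<M. \<Sum>n<M. A n * B n)"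
    by (intro sum.cong refl sum_periodic_shift[where F="\<lambda>n. A n * B n"]) (simp add: AM BM)
  finally show ?thesis by simp
qed

lemma prod_primes_power_dvd_iff:
  fixes A :: "nat set"
  assumes "finite A" "\<And>p. p \<in> A \<Longrightarrow> prime p"
  shows "(\<Prod>A) ^ k dvd m \<longleftrightarrow> (\<forall>p\<in>A. p ^ k dvd m)"
  using assms
proof (induction A rule: finite_induct)
  case (insert p A)
  have "coprime (p ^ k) ((\<Prod>A) ^ k)"
    using insert by (intro coprime_power_left_iff[THEN iffD2] coprime_power_right_iff[THEN iffD2] disjI1 prod_coprime_right)
      (auto intro!: primes_coprime)
  then have "p ^ k * (\<Prod>A) ^ k dvd m \<longleftrightarrow> p ^ k dvd m \<and> (\<Prod>A) ^ k dvd m"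
    by (auto intro: divides_mult dest: dvd_mult_left dvd_mult_right)
  then show ?case using insert by (simp add: power_mult_distrib)
qed auto

lemma prod_primes_inj:
  fixes A B :: "nat set"
  assumes "finite A" "\<And>p. p \<in> A \<Longrightarrow> prime p" "finite B" "\<And>p. p \<in> B \<Longrightarrow> prime p" "\<Prod>A = \<Prod>B"
  shows "A = B"
proof -
  have *: "p dvd \<Prod>X \<longleftrightarrow> p \<in> X" if "prime p" "finite X" "\<And>p. p \<in> X \<Longrightarrow> prime p" for p :: nat and X
    using prime_dvd_prod_iff[OF that(2,1), of "\<lambda>x. x"] that(1,3) by (metis dvd_refl primes_dvd_imp_eq)
  show ?thesis using *[of _ A] *[of _ B] assms by (metis (no_types, lifting) subsetI subset_antisym)
qed

text \<open>As \<open>0 < n + h\<close> and \<open>n + h \<le> 2 * N\<close>, the quotient lies in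
  \<open>{1..(2 * N) div q}\<close>. The bound has no additive 1, so it can be summed over
  arbitrarily many \<open>q\<close>.\<close>

lemma card_multiples_le:
  fixes q h N :: nat
  assumes "q > 0" "h \<le> N"
  shows "real (card {n \<in> {1..N}. q dvd n + h}) \<le> 2 * real N / real q"
proof -
  have "{n \<in> {1..N}. q dvd n + h} \<subseteq> (\<lambda>t. q * t - h) ` {1..(2 * N) div q}"
  proof
    fix n assume n: "n \<in> {n \<in> {1..N}. q dvd n + h}"
    then obtain t where t: "n + h = q * t" by auto
    have "t \<ge> 1" using t n by (cases t) auto
    moreover have "t \<le> (2 * N) div q" using t n assms by (subst less_eq_div_iff_mult_less_eq) (auto simp: mult.commute)
    moreover have "n = q * t - h" using t by simp
    ultimately show "n \<in> (\<lambda>t. q * t - h) ` {1..(2 * N) div q}" by auto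
  qed
  then have "card {n \<in> {1..N}. q dvd n + h} \<le> card {1..(2 * N) div q}"
    by (meson surj_card_le finite_atLeastAtMost)
  also have "\<dots> = (2 * N) div q" by simp
  finally have "real (card {n \<in> {1..N}. q dvd n + h}) \<le> real ((2 * N) div q)" by simp
  also have "\<dots> \<le> real (2 * N) / real q" by (rule of_nat_div_le_of_nat)
  finally show ?thesis by simp
qed

lemma card_filter_eq_sum:
  "finite X \<Longrightarrow> real (card {x\<in>X. Q x}) = (\<Sum>x\<in>X. of_bool (Q x))"
  by (simp add: of_bool_def sum.If_cases Int_def)

section \<open>Fluctuations, counting functions and uniform bounds for sets of primes\<close>

definition dev :: "nat \<Rightarrow> nat \<Rightarrow> nat \<Rightarrow> real" where
  "dev k p m = of_bool (p ^ k dvd m) - 1 / real p ^ k"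

definition gdev :: "nat \<Rightarrow> nat \<Rightarrow> nat set \<Rightarrow> nat \<Rightarrow> real" where
  "gdev k H S n = (\<Sum>h<H. \<Prod>p\<in>S. dev k p (n + h))"

definition cnt :: "nat \<Rightarrow> nat \<Rightarrow> nat set \<Rightarrow> nat \<Rightarrow> real" where
  "cnt k H A n = (\<Sum>h<H. of_bool (\<forall>p\<in>A. p ^ k dvd n + h))"

text \<open>A constant of its own, since the simplifier would move the coercion into the product.\<close>

definition rprod :: "nat set \<Rightarrow> real" where
  "rprod S = real (\<Prod>S)"

lemma rprod_nonneg: "rprod S \<ge> 0"
  by (simp only: rprod_def of_nat_0_le_iff)

lemma cnt_nonneg: "cnt k H A n \<ge> 0"
  by (simp add: cnt_def sum_nonneg)

lemma prod_of_bool: "finite A \<Longrightarrow> (\<Prod>p\<in>A. of_bool (Q p)) = (of_bool (\<forall>p\<in>A. Q p) :: real)"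
  by (induction A rule: finite_induct) auto

lemma prod_inverse_power:
  "(\<Prod>p\<in>A. 1 / real p ^ k) = 1 / rprod A ^ k"
  by (simp add: rprod_def prod_dividef prod_power_distrib)

text \<open>A prime with \<open>K > p powr \<delta>\<close> is at most \<open>B\<close>, so at most
  \<open>Suc B\<close> factors \<open>K\<close> are not covered by the power of their own prime.
  This is the usual bound for a constant to the number of prime factors, uniform in
  \<open>U\<close>.\<close>

lemma power_card_primes_le:
  fixes K \<delta> :: real
  assumes "K \<ge> 1" "\<delta> > 0"
  obtains C where "C \<ge> 1" "\<And>U. finite U \<Longrightarrow> (\<And>p. p \<in> U \<Longrightarrow> prime p) \<Longrightarrow> K ^ card U \<le> C * rprod U powr \<delta>"
proof -
  define B where "B = nat \<lceil>K powr (1 / \<delta>)\<rceil>"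
  have C1: "K ^ Suc B \<ge> 1" using assms by (intro one_le_power) auto
  show thesis
  proof (rule that[OF C1])
    fix U :: "nat set" assume U: "finite U" "\<And>p. p \<in> U \<Longrightarrow> prime p"
    define U1 where "U1 = {p\<in>U. p \<le> B}"
    define U2 where "U2 = {p\<in>U. p > B}"
    have UU: "U = U1 \<union> U2" "U1 \<inter> U2 = {}" "finite U1" "finite U2" using U by (auto simp: U1_def U2_def)
    have ge1: "real p powr \<delta> \<ge> 1" if "p \<in> U" for p
      using U(2)[OF that] assms by (intro ge_one_powr_ge_zero) (auto dest: prime_ge_1_nat)
    have "card U1 \<le> card {..B}" by (intro card_mono) (auto simp: U1_def)
    then have 1: "K ^ card U1 \<le> K ^ Suc B" using assms by (intro power_increasing) auto
    have "K ^ card U2 = (\<Prod>p\<in>U2. K)" by simp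
    also have "\<dots> \<le> (\<Prod>p\<in>U2. real p powr \<delta>)"
    proof (intro prod_mono conjI)
      fix p assume "p \<in> U2"
      then have "K powr (1 / \<delta>) \<le> real p" unfolding U2_def B_def by (auto simp: less_imp_le) linarith
      then have "(K powr (1 / \<delta>)) powr \<delta> \<le> real p powr \<delta>" using assms by (intro powr_mono2) auto
      then show "K \<le> real p powr \<delta>" using assms by (simp add: powr_powr)
    qed (use assms in auto)
    also have "\<dots> \<le> (\<Prod>p\<in>U. real p powr \<delta>)"
      using U ge1 by (intro prod_mono2) (auto simp: U2_def)
    also have "\<dots> = rprod U powr \<delta>"
      by (simp add: rprod_def prod_powr_distrib)
    finally have 2: "K ^ card U2 \<le> rprod U powr \<delta>" .
    have "K ^ card U = K ^ card U1 * K ^ card U2"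
      using UU by (simp add: card_Un_disjoint power_add)
    also have "\<dots> \<le> K ^ Suc B * rprod U powr \<delta>" using 1 2 assms by (intro mult_mono) auto
    finally show "K ^ card U \<le> K ^ Suc B * rprod U powr \<delta>" .
  qed
qed

text \<open>By unique factorization the products over distinct sets of primes are distinct integers,
  so the sum is part of the convergent series of n^-(1+\<delta>), whatever \<open>P\<close>
  is.\<close>

lemma sum_rprod_powr_le:
  fixes \<delta> :: real
  assumes "\<delta> > 0"
  obtains Z where "Z \<ge> 1" "\<And>P. finite P \<Longrightarrow> (\<And>p. p \<in> P \<Longrightarrow> prime p) \<Longrightarrow> (\<Sum>U\<in>Pow P. rprod U powr - (1 + \<delta>)) \<le> Z"
proof -
  define f where "f = (\<lambda>n::nat. real n powr - (1 + \<delta>))"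
  have f: "summable f" unfolding f_def using assms by (simp add: summable_real_powr_iff)
  show thesis
  proof (rule that[of "max 1 (suminf f)"])
    fix P :: "nat set" assume P: "finite P" "\<And>p. p \<in> P \<Longrightarrow> prime p"
    have inj: "inj_on Prod (Pow P)"
    proof (rule inj_onI)
      fix A B assume "A \<in> Pow P" "B \<in> Pow P" "\<Prod>A = \<Prod>B"
      then show "A = B" using P finite_subset by (intro prod_primes_inj) blast+
    qed
    have "(\<Sum>U\<in>Pow P. rprod U powr - (1 + \<delta>)) = (\<Sum>U\<in>Pow P. f (\<Prod>U))"
      by (simp only: f_def rprod_def)
    also have "\<dots> = sum f (Prod ` Pow P)" using inj by (simp add: sum.reindex)
    also have "\<dots> \<le> suminf f" using P f by (intro sum_le_suminf) (auto simp: f_def)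
    finally show "(\<Sum>U\<in>Pow P. rprod U powr - (1 + \<delta>)) \<le> max 1 (suminf f)" by simp
  qed simp
qed

section \<open>Mean values of products of fluctuations\<close>

text \<open>Here \<open>e\<close>, \<open>a\<close> and \<open>T\<close> will be the product over
  \<open>S\<close>, the product over \<open>S \<inter> W\<close> and the k-th root of
  \<open>H\<close>. The k-th power is lowered to the first: with \<open>z = max T a / e\<close> the
  minimum is at most \<open>min 1 (2 * z ^ k)\<close>, hence at most
  \<open>2 * min 1 z\<close>.\<close>

lemma local_factor_le:
  fixes a e T :: real
  assumes "1 \<le> a" "a \<le> e" "1 \<le> T" "k \<ge> 1"
  shows "(e / a) * min 1 ((T ^ k + a ^ k) / e ^ k) \<le> 2 * (max (min e T) a / a)"
proof -
  define z where "z = max T a / e"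
  have z: "z \<ge> 0" using assms by (simp add: z_def)
  have "T ^ k \<le> (max T a) ^ k" "a ^ k \<le> (max T a) ^ k" using assms by (auto intro!: power_mono)
  then have "T ^ k + a ^ k \<le> 2 * (max T a) ^ k" by linarith
  then have "(T ^ k + a ^ k) / e ^ k \<le> (2 * (max T a) ^ k) / e ^ k"
    using assms by (intro divide_right_mono) auto
  also have "\<dots> = 2 * z ^ k" by (simp add: z_def power_divide)
  finally have "min 1 ((T ^ k + a ^ k) / e ^ k) \<le> min 1 (2 * z ^ k)" by auto
  also have "\<dots> \<le> 2 * min 1 z"
  proof (cases "z \<le> 1")
    case True
    then have "z ^ k \<le> z ^ 1" using z assms by (intro power_decreasing) auto
    then show ?thesis using True by simp
  qed auto
  finally have "(e / a) * min 1 ((T ^ k + a ^ k) / e ^ k) \<le> (e / a) * (2 * min 1 z)"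
    using assms by (intro mult_left_mono) auto
  also have "\<dots> = 2 * ((e * min 1 z) / a)" by simp
  also have "e * min 1 z = min e (max T a)"
    using assms by (simp add: z_def min_def field_simps)
  also have "\<dots> \<le> max (min e T) a" by auto
  finally show ?thesis using assms by (auto simp: divide_right_mono)
qed

text \<open>For one set of the tuple, \<open>a\<close> and \<open>b\<close> belong to its overlaps
  with the sets before and after it, and \<open>e \<le> a * b\<close> holds when each of its primes
  recurs elsewhere. The two orders of averaging together cost \<open>T\<close>, so their geometric
  mean costs \<open>sqrt T\<close> per set.\<close>

lemma local_factor_pair_le:
  fixes a b e T :: real
  assumes "1 \<le> a" "1 \<le> b" "e \<le> a * b" "1 \<le> T" "1 \<le> e"
  shows "(max (min e T) a / a) * (max (min e T) b / b) \<le> T"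
proof -
  define m where "m = min e T"
  have m: "1 \<le> m" "m \<le> T" "m \<le> a * b" using assms by (auto simp: m_def)
  have "max m a * max m b \<le> T * (a * b)"
  proof (cases "m \<le> a"; cases "m \<le> b")
    assume "m \<le> a" "m \<le> b"
    then show ?thesis using assms by simp
  next
    assume "m \<le> a" "\<not> m \<le> b"
    moreover have "a * m \<le> a * (T * b)" 
      using m assms mult_mono[of m T 1 b] by (intro mult_left_mono) auto
    ultimately show ?thesis by (simp add: mult_ac)
  next
    assume "\<not> m \<le> a" "m \<le> b"
    moreover have "b * m \<le> b * (T * a)" 
      using m assms mult_mono[of m T 1 a] by (intro mult_left_mono) auto
    ultimately show ?thesis by (simp add: mult_ac)
  next
    assume "\<not> m \<le> a" "\<not> m \<le> b"
    then show ?thesis using mult_mono[of m T m "a * b"] m by simp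
  qed
  then show ?thesis using assms by (simp add: m_def field_simps)
qed

section \<open>The fluctuations for a fixed finite set of primes\<close>

locale prime_family =
  fixes P :: "nat set" and k H :: nat
  assumes finite_P: "finite P" and prime_P: "\<And>p. p \<in> P \<Longrightarrow> prime p" and k_pos: "k \<ge> 1" and H_pos: "H \<ge> 1"
begin

text \<open>A common period of all \<open>gdev k H S\<close> with
  \<open>S \<subseteq> P\<close>.\<close>

definition M :: nat where "M = (\<Prod>P) ^ k"

lemma finite_subset_P: "S \<subseteq> P \<Longrightarrow> finite S"
  using finite_P finite_subset by blast

lemma prod_pos_P: "S \<subseteq> P \<Longrightarrow> \<Prod>S > 0"
  using prime_P by (intro prod_pos) (auto simp: prime_gt_0_nat)

lemma prod_ge_1_P: "S \<subseteq> P \<Longrightarrow> rprod S \<ge> 1"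
  using prod_pos_P[of S] unfolding rprod_def by linarith

lemma prod_mono_P: "S \<subseteq> S' \<Longrightarrow> S' \<subseteq> P \<Longrightarrow> rprod S \<le> rprod S'"
  using prod_pos_P[of S'] finite_subset_P[of S'] 
  unfolding rprod_def by (intro of_nat_mono dvd_imp_le prod_dvd_prod_subset) auto

lemma prod_split_P: "A \<subseteq> S \<Longrightarrow> S \<subseteq> P \<Longrightarrow> rprod S = rprod A * rprod (S - A)"
  using finite_subset_P[of S] by (simp add: rprod_def prod.subset_diff[of A S] mult.commute)

lemma power_dvd_P: "A \<subseteq> P \<Longrightarrow> (\<Prod>A) ^ k dvd m \<longleftrightarrow> (\<forall>p\<in>A. p ^ k dvd m)"
  using finite_subset_P prime_P by (intro prod_primes_power_dvd_iff) auto

lemma M_pos: "M > 0"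
  using prod_pos_P[of P] by (simp add: M_def)

lemma gdev_expand:
  assumes "S \<subseteq> P"
  shows "gdev k H S n = (\<Sum>A\<in>Pow S. (-1) ^ (card S - card A) / rprod (S - A) ^ k * cnt k H A n)"
proof -
  have fin: "finite A" if "A \<subseteq> S" for A using that assms finite_subset_P by blast
  have "gdev k H S n = (\<Sum>h<H. \<Sum>A\<in>Pow S. (-1) ^ (card S - card A) * of_bool (\<forall>p\<in>A. p ^ k dvd n + h) * (1 / rprod (S - A) ^ k))"
    unfolding gdev_def dev_def using fin
    by (intro sum.cong refl, subst prod_diff_conv_sum')
       (auto simp: prod_of_bool prod_inverse_power intro!: sum.cong)
  also have "\<dots> = (\<Sum>A\<in>Pow S. \<Sum>h<H. (-1) ^ (card S - card A) * of_bool (\<forall>p\<in>A. p ^ k dvd n + h) * (1 / rprod (S - A) ^ k))"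
    by (rule sum.swap)
  also have "\<dots> = (\<Sum>A\<in>Pow S. (-1) ^ (card S - card A) / rprod (S - A) ^ k * cnt k H A n)"
    unfolding cnt_def sum_distrib_left by (intro sum.cong refl) (simp add: mult_ac)
  finally show ?thesis .
qed

lemma gdev_le_cnt:
  assumes "S \<subseteq> P"
  shows "\<bar>gdev k H S n\<bar> \<le> (\<Sum>A\<in>Pow S. cnt k H A n / rprod (S - A) ^ k)"
  unfolding gdev_expand[OF assms] 
  by (rule order_trans[OF sum_abs]) (auto simp: abs_mult power_abs cnt_nonneg rprod_nonneg intro!: sum_mono)

lemma cnt_approx:
  assumes "A \<subseteq> P"
  shows "\<bar>cnt k H A n - real H / rprod A ^ k\<bar> \<le> 1"
proof -
  have "cnt k H A n = (\<Sum>h<H. of_bool ((\<Prod>A) ^ k dvd n + h))"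
    unfolding cnt_def using power_dvd_P[OF assms] by simp
  also have "\<dots> = (\<Sum>m\<in>{n..<n+H}. of_bool (m mod (\<Prod>A) ^ k = 0))"
    by (rule sum.reindex_bij_witness[of _ "\<lambda>m. m - n" "\<lambda>h. n + h"]) (auto simp: dvd_eq_mod_eq_0)
  also have "\<dots> = real (card {m \<in> {n..<n+H}. m mod (\<Prod>A) ^ k = 0})"
    by (simp add: of_bool_def sum.If_cases Int_def)
  finally show ?thesis
    using card_residue_class_approx[of 0 "(\<Prod>A) ^ k" n H] prod_pos_P[OF assms] by (simp add: rprod_def)
qed

text \<open>The terms \<open>real H / rprod A ^ k\<close> may be subtracted from the counts, because
  their total is a multiple of the alternating sum over the subsets of \<open>S\<close>, which
  vanishes for nonempty \<open>S\<close>. Each of the \<open>2 ^ card S\<close> remaining terms is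
  at most 1.\<close>

lemma gdev_bound:
  assumes S: "S \<subseteq> P" "S \<noteq> {}"
  shows "\<bar>gdev k H S n\<bar> \<le> 2 ^ card S"
proof -
  have fin: "finite S" using finite_subset_P S by auto
  \<comment> \<open>The alternating sum over subsets arises by multiplying out factors 1 - 1, of
    which there is at least one.\<close>
  have "0 = (\<Prod>p\<in>S. 1 - (1::real))" using S fin by (simp add: card_gt_0_iff)
  also have "\<dots> = (\<Sum>A\<in>Pow S. (-1) ^ (card S - card A))"
    by (subst prod_diff_conv_sum'[OF fin]) simp
  finally have z: "(\<Sum>A\<in>Pow S. (-1) ^ (card S - card A)) = (0::real)" ..
  have "(\<Sum>A\<in>Pow S. (-1) ^ (card S - card A) / rprod (S - A) ^ k * (real H / rprod A ^ k))
      = (\<Sum>A\<in>Pow S. (-1) ^ (card S - card A) * (real H / rprod S ^ k))"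
    using S by (intro sum.cong refl) (auto simp: prod_split_P[of _ S] power_mult_distrib mult_ac)
  also have "\<dots> = 0" unfolding sum_distrib_right[symmetric] z by simp
  finally have "gdev k H S n = (\<Sum>A\<in>Pow S. (-1) ^ (card S - card A) / rprod (S - A) ^ k * (cnt k H A n - real H / rprod A ^ k))"
    unfolding gdev_expand[OF S(1)] right_diff_distrib sum_subtractf by simp
  also have "\<bar>\<dots>\<bar> \<le> (\<Sum>A\<in>Pow S. 1)"
  proof (rule order_trans[OF sum_abs], rule sum_mono)
    fix A assume "A \<in> Pow S"
    then have A: "A \<subseteq> P" "S - A \<subseteq> P" using S by auto
    have "\<bar>(-1) ^ (card S - card A) / rprod (S - A) ^ k * (cnt k H A n - real H / rprod A ^ k)\<bar>
      = 1 / rprod (S - A) ^ k * \<bar>cnt k H A n - real H / rprod A ^ k\<bar>"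
      by (simp add: abs_mult power_abs rprod_nonneg)
    also have "\<dots> \<le> 1 * 1" 
      using prod_ge_1_P[OF A(2)] cnt_approx[OF A(1), of n] by (intro mult_mono) auto
    finally show "\<bar>(-1) ^ (card S - card A) / rprod (S - A) ^ k * (cnt k H A n - real H / rprod A ^ k)\<bar> \<le> 1"
      by simp
  qed
  finally show ?thesis using fin by (simp add: card_Pow)
qed

lemma gdev_periodic:
  assumes "\<And>p. p \<in> S \<Longrightarrow> p ^ k dvd u"
  shows "gdev k H S (n + u) = gdev k H S n"
proof -
  have "p ^ k dvd n + u + h \<longleftrightarrow> p ^ k dvd n + h" if "p \<in> S" for p h
    using assms[OF that] by (metis add.assoc add.commute dvd_add_left_iff)
  then show ?thesis by (simp add: gdev_def dev_def)
qed

lemma gdev_periodic_M: "S \<subseteq> P \<Longrightarrow> gdev k H S (n + M) = gdev k H S n"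
  using power_dvd_P[of P M] by (intro gdev_periodic) (auto simp: M_def)

text \<open>Along the progression the conditions at primes of \<open>W\<close> do not change, while
  those at primes outside \<open>W\<close> are equidistributed, since the step is coprime to these
  primes.\<close>

lemma sum_cnt_progression:
  assumes A: "A \<subseteq> P" and W: "W \<subseteq> P"
  shows "(\<Sum>t<M. cnt k H A (n + (\<Prod>W) ^ k * t)) = real M / rprod (A - W) ^ k * cnt k H (A \<inter> W) n"
proof -
  let ?u = "(\<Prod>W) ^ k" and ?q = "(\<Prod>(A - W)) ^ k"
  have cop: "coprime ?u ?q"
    using A W prime_P 
    by (intro coprime_power_left_iff[THEN iffD2] coprime_power_right_iff[THEN iffD2] disjI1 prod_coprime_right prod_coprime_left)
      (auto intro!: primes_coprime)
  have qM: "?q dvd M"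
    using A finite_P unfolding M_def by (intro dvd_power_same prod_dvd_prod_subset) auto
  have 1: "(\<forall>p\<in>A. p ^ k dvd n + ?u * t + h) \<longleftrightarrow> (\<forall>p\<in>A\<inter>W. p ^ k dvd n + h) \<and> ?q dvd (n + h) + ?u * t" for t h
  proof -
    have "p ^ k dvd n + ?u * t + h \<longleftrightarrow> p ^ k dvd n + h" if "p \<in> A \<inter> W" for p
    proof -
      have "p ^ k dvd ?u * t" using that power_dvd_P[OF W, of ?u] by auto
      then show ?thesis by (metis add.assoc add.commute dvd_add_left_iff)
    qed
    moreover have "?q dvd (n + h) + ?u * t \<longleftrightarrow> (\<forall>p\<in>A-W. p ^ k dvd n + ?u * t + h)"
      using A by (subst power_dvd_P) (auto simp: ac_simps)
    ultimately show ?thesis by blast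
  qed
  have "(\<Sum>t<M. cnt k H A (n + ?u * t)) = (\<Sum>h<H. \<Sum>t<M. of_bool (\<forall>p\<in>A. p ^ k dvd n + ?u * t + h))"
    unfolding cnt_def by (rule sum.swap)
  also have "\<dots> = (\<Sum>h<H. of_bool (\<forall>p\<in>A\<inter>W. p ^ k dvd n + h) * (\<Sum>t<M. of_bool (?q dvd (n + h) + ?u * t)))"
    unfolding 1 of_bool_conj sum_distrib_left ..
  also have "\<dots> = (\<Sum>h<H. of_bool (\<forall>p\<in>A\<inter>W. p ^ k dvd n + h) * (real M / rprod (A - W) ^ k))"
  proof (rule sum.cong[OF refl], rule arg_cong2[where f="(*)"], rule refl)
    fix h
    have "(\<Sum>t<M. of_bool (?q dvd (n + h) + ?u * t)) = real (card {t \<in> {..<M}. ?q dvd (n + h) + ?u * t})"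
      by (simp add: of_bool_def sum.If_cases Int_def)
    also have "\<dots> = real M / real ?q" by (rule card_linear_congruence[OF cop qM M_pos])
    finally show "(\<Sum>t<M. of_bool (?q dvd (n + h) + ?u * t)) = real M / rprod (A - W) ^ k" by (simp add: rprod_def)
  qed
  also have "\<dots> = real M / rprod (A - W) ^ k * cnt k H (A \<inter> W) n"
    unfolding cnt_def sum_distrib_left by (simp only: mult.commute)
  finally show ?thesis .
qed

text \<open>In \<open>gdev_le_cnt\<close> the means account for the primes of \<open>S - A\<close>
  and the average along the progression for those of \<open>A - W\<close>. Together with
  \<open>A \<inter> W\<close> these sets make up \<open>S\<close>, so every \<open>A\<close> leads
  to the same denominator \<open>rprod S ^ k\<close>.\<close>

lemma average_gdev_progression:
  assumes S: "S \<subseteq> P" and W: "W \<subseteq> P"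
  shows "(\<Sum>t<M. \<bar>gdev k H S (n + (\<Prod>W) ^ k * t)\<bar>)
     \<le> real M * (2 ^ card S * ((real H + rprod (S \<inter> W) ^ k) / rprod S ^ k))"
proof -
  let ?u = "(\<Prod>W) ^ k"
  have "(\<Sum>t<M. \<bar>gdev k H S (n + ?u * t)\<bar>) \<le> (\<Sum>t<M. \<Sum>A\<in>Pow S. cnt k H A (n + ?u * t) / rprod (S - A) ^ k)"
    by (intro sum_mono gdev_le_cnt S)
  also have "\<dots> = (\<Sum>A\<in>Pow S. (\<Sum>t<M. cnt k H A (n + ?u * t)) / rprod (S - A) ^ k)"
    by (subst sum.swap) (simp add: sum_divide_distrib)
  also have "\<dots> \<le> (\<Sum>A\<in>Pow S. real M * ((real H + rprod (S \<inter> W) ^ k) / rprod S ^ k))"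
  proof (rule sum_mono)
    fix A assume "A \<in> Pow S"
    then have A: "A \<subseteq> S" "A \<subseteq> P" "S - A \<subseteq> P" "A - W \<subseteq> P" "A \<inter> W \<subseteq> P" using S by auto
    have "(\<Sum>t<M. cnt k H A (n + ?u * t)) / rprod (S - A) ^ k
       = real M / (rprod (S - A) ^ k * rprod (A - W) ^ k) * cnt k H (A \<inter> W) n"
      unfolding sum_cnt_progression[OF A(2) W] by (simp add: mult_ac)
    also have "\<dots> \<le> real M / (rprod (S - A) ^ k * rprod (A - W) ^ k) * (real H / rprod (A \<inter> W) ^ k + 1)"
      using cnt_approx[OF A(5), of n] by (intro mult_left_mono) (auto simp: rprod_nonneg)
    also have "\<dots> = real M * ((real H + rprod (A \<inter> W) ^ k) / rprod S ^ k)"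
    proof -
      have "rprod S = rprod (A \<inter> W) * rprod (A - W) * rprod (S - A)"
        using prod_split_P[OF A(1) S] prod_split_P[of "A \<inter> W" A] A by (simp add: Diff_Int)
      moreover have "rprod (A \<inter> W) > 0" using prod_ge_1_P[OF A(5)] by simp
      ultimately show ?thesis by (simp add: field_simps power_mult_distrib)
    qed
    also have "\<dots> \<le> real M * ((real H + rprod (S \<inter> W) ^ k) / rprod S ^ k)"
      using S A by (intro mult_left_mono divide_right_mono add_left_mono power_mono prod_mono_P) (auto simp: rprod_nonneg)
    finally show "(\<Sum>t<M. cnt k H A (n + ?u * t)) / rprod (S - A) ^ k \<le> real M * ((real H + rprod (S \<inter> W) ^ k) / rprod S ^ k)" .
  qed
  also have "\<dots> = real M * (2 ^ card S * ((real H + rprod (S \<inter> W) ^ k) / rprod S ^ k))"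
    using finite_subset_P[OF S] by (simp add: card_Pow)
  finally show ?thesis .
qed

text \<open>A step coprime to \<open>p\<close> spreads the progression evenly over the classes
  modulo \<open>p ^ k\<close>, over which \<open>dev k p\<close> has mean zero.\<close>

lemma sum_dev_progression:
  assumes p: "p \<in> P" and W: "W \<subseteq> P" "p \<notin> W"
  shows "(\<Sum>t<M. dev k p (m + (\<Prod>W) ^ k * t)) = 0"
proof -
  have cop: "coprime ((\<Prod>W) ^ k) (p ^ k)"
    using p W prime_P 
    by (intro coprime_power_left_iff[THEN iffD2] coprime_power_right_iff[THEN iffD2] disjI1 prod_coprime_left)
      (auto intro!: primes_coprime)
  have "p ^ k dvd M" using p finite_P unfolding M_def by (intro dvd_power_same dvd_prodI) auto
  from card_linear_congruence[OF cop this M_pos, of m] show ?thesis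
    by (simp add: dev_def sum_subtractf of_bool_def sum.If_cases Int_def)
qed

text \<open>The better of the pointwise bound \<open>gdev_bound\<close> and the average bound
  \<open>average_gdev_progression\<close>.\<close>

definition avg_bound :: "nat set \<Rightarrow> nat set \<Rightarrow> real" where
  "avg_bound S W = 2 ^ card S * min 1 ((real H + rprod (S \<inter> W) ^ k) / rprod S ^ k)"

lemma avg_bound_nonneg: "avg_bound S W \<ge> 0"
  by (simp add: avg_bound_def rprod_nonneg)

text \<open>The induction splits off the last factor: the earlier ones are periodic modulo
  \<open>(\<Prod>W) ^ k\<close>, so the last may be replaced by its average over a class to this
  modulus, and the bound for that average does not depend on the class.\<close>

lemma sequential_average:
  fixes l :: nat and s :: "nat \<Rightarrow> nat set"
  assumes "\<And>i. i < l \<Longrightarrow> s i \<subseteq> P \<and> s i \<noteq> {}"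
  shows "(\<Sum>n<M. \<Prod>i<l. \<bar>gdev k H (s i) n\<bar>) \<le> real M * (\<Prod>i<l. avg_bound (s i) (\<Union>j<i. s j))"
  using assms
proof (induction l)
  case (Suc l)
  define W where "W = (\<Union>j<l. s j)"
  define A where "A = (\<lambda>n. \<Prod>i<l. \<bar>gdev k H (s i) n\<bar>)"
  define B where "B = (\<lambda>n. \<bar>gdev k H (s l) n\<bar>)"
  let ?u = "(\<Prod>W) ^ k" and ?b = "avg_bound (s l) W"
  have W: "W \<subseteq> P" using Suc.prems by (auto simp: W_def less_Suc_eq)
  have sl: "s l \<subseteq> P" "s l \<noteq> {}" using Suc.prems by auto
  have "gdev k H (s i) (n + ?u) = gdev k H (s i) n" if "i < l" for i n
    using that power_dvd_P[OF W, of ?u] by (intro gdev_periodic) (auto simp: W_def)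
  then have Au: "A (n + ?u) = A n" for n by (simp add: A_def)
  have AM: "A (n + M) = A n" and BM: "B (n + M) = B n" for n
    using Suc.prems by (simp_all add: A_def B_def gdev_periodic_M)
  have A0: "A n \<ge> 0" for n by (simp add: A_def prod_nonneg)
  have "real M * (\<Sum>n<M. A n * B n) = (\<Sum>n<M. A n * (\<Sum>t<M. B (n + ?u * t)))"
    by (rule sum_periodic_average[of A ?u M B, OF Au AM BM])
  also have "\<dots> \<le> (\<Sum>n<M. A n * (real M * ?b))"
  proof (intro sum_mono mult_left_mono A0)
    fix n
    have "(\<Sum>t<M. B (n + ?u * t)) \<le> (\<Sum>t<M. 2 ^ card (s l))"
      unfolding B_def by (intro sum_mono gdev_bound sl)
    moreover have "(\<Sum>t<M. B (n + ?u * t)) \<le> real M * (2 ^ card (s l) * ((real H + rprod (s l \<inter> W) ^ k) / rprod (s l) ^ k))"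
      unfolding B_def by (rule average_gdev_progression[OF sl(1) W])
    ultimately show "(\<Sum>t<M. B (n + ?u * t)) \<le> real M * ?b"
      by (auto simp: avg_bound_def min_def)
  qed
  also have "\<dots> = real M * (?b * (\<Sum>n<M. A n))"
    unfolding sum_distrib_left by (intro sum.cong) (auto simp: mult_ac)
  also have "\<dots> \<le> real M * (?b * (real M * (\<Prod>i<l. avg_bound (s i) (\<Union>j<i. s j))))"
    unfolding A_def using Suc by (intro mult_left_mono avg_bound_nonneg) auto
  finally have "(\<Sum>n<M. A n * B n) \<le> ?b * (real M * (\<Prod>i<l. avg_bound (s i) (\<Union>j<i. s j)))"
    using M_pos by simp
  then show ?case by (simp add: A_def B_def W_def mult_ac)
qed simp

text \<open>The quotient at \<open>i\<close> is the product of the primes that occur in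
  \<open>s i\<close> but in no earlier set.\<close>

lemma rprod_Union_telescope:
  fixes l :: nat and s :: "nat \<Rightarrow> nat set"
  assumes "\<And>i. i < l \<Longrightarrow> s i \<subseteq> P"
  shows "(\<Prod>i<l. rprod (s i) / rprod (s i \<inter> (\<Union>j<i. s j))) = rprod (\<Union>i<l. s i)"
  using assms
proof (induction l)
  case 0 show ?case by (simp add: rprod_def)
next
  case (Suc l)
  define W where "W = (\<Union>j<l. s j)"
  have W: "W \<subseteq> P" using Suc.prems by (auto simp: W_def less_Suc_eq)
  have sl: "s l \<subseteq> P" using Suc.prems by auto
  have "rprod (s l) = rprod (s l \<inter> W) * rprod (s l - W)"
    using prod_split_P[of "s l \<inter> W" "s l"] sl by (simp add: Diff_Int)
  moreover have "rprod (s l \<inter> W) \<ge> 1" using sl by (intro prod_ge_1_P) auto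
  moreover have "rprod (W \<union> s l) = rprod W * rprod (s l - W)"
    using prod_split_P[of W "W \<union> s l"] sl W by (simp add: Un_Diff)
  ultimately show ?case using Suc by (simp add: W_def lessThan_Suc Un_commute)
qed

text \<open>Averaging in the given and in the reversed order gives two bounds for the same mean.
  They are multiplied, and telescoping in both orders distributes the squared product over the
  factors. By \<open>cover\<close>, each set then contributes one factor \<open>T\<close>, up to
  powers of 2, to the square.\<close>

lemma mean_bound:
  fixes l :: nat and s :: "nat \<Rightarrow> nat set"
  assumes s: "\<And>i. i < l \<Longrightarrow> s i \<subseteq> P \<and> s i \<noteq> {}"
    and cover: "\<And>i p. i < l \<Longrightarrow> p \<in> s i \<Longrightarrow> \<exists>j<l. j \<noteq> i \<and> p \<in> s j"
  shows "(\<Sum>n<M. \<Prod>i<l. \<bar>gdev k H (s i) n\<bar>) * rprod (\<Union>i<l. s i)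
      \<le> real M * (2 ^ l * (\<Prod>i<l. 2 ^ card (s i)) * real H powr (real l / (2 * real k)))"
proof -
  define F where "F = (\<Sum>n<M. \<Prod>i<l. \<bar>gdev k H (s i) n\<bar>)"
  define T where "T = real H powr (1 / real k)"
  define U where "U = (\<Union>i<l. s i)"
  define W where "W = (\<lambda>i. \<Union>j<i. s j)"
  define W' where "W' = (\<lambda>i. \<Union>j\<in>{i<..<l}. s j)"
  have T: "T \<ge> 1" "T ^ k = real H"
    using H_pos k_pos by (simp_all add: T_def ge_one_powr_ge_zero powr_powr flip: powr_realpow)
  have F0: "F \<ge> 0" by (simp add: F_def sum_nonneg prod_nonneg)
  have F1: "F \<le> real M * (\<Prod>i<l. avg_bound (s i) (W i))"
    unfolding F_def W_def by (rule sequential_average[OF s])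
  have U1: "rprod U = (\<Prod>i<l. rprod (s i) / rprod (s i \<inter> W i))"
    unfolding U_def W_def using s by (subst rprod_Union_telescope) auto
  \<comment> \<open>The reversed tuple: the sets before position \<open>l - Suc i\<close> in it are
    those after position \<open>i\<close> in \<open>s\<close>, with union
    \<open>W' i\<close>.\<close>
  define r where "r = (\<lambda>i. s (l - Suc i))"
  have r: "\<And>i. i < l \<Longrightarrow> r i \<subseteq> P \<and> r i \<noteq> {}" using s by (simp add: r_def)
  have rW: "(\<Union>j<l - Suc i. r j) = W' i" if "i < l" for i
  proof -
    have "(\<lambda>j. l - Suc j) ` {..<l - Suc i} = {i<..<l}"
    proof (intro equalityI subsetI)
      fix j assume "j \<in> {i<..<l}"
      then show "j \<in> (\<lambda>j. l - Suc j) ` {..<l - Suc i}"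
        by (intro image_eqI[of _ _ "l - Suc j"]) auto
    qed auto
    then show ?thesis unfolding r_def W'_def by (metis image_image)
  qed
  have rU: "(\<Union>i<l. r i) = U"
  proof -
    have "(\<lambda>j. l - Suc j) ` {..<l} = {..<l}"
    proof (intro equalityI subsetI)
      fix j assume "j \<in> {..<l}"
      then show "j \<in> (\<lambda>j. l - Suc j) ` {..<l}"
        by (intro image_eqI[of _ _ "l - Suc j"]) auto
    qed auto
    then show ?thesis unfolding r_def U_def by (metis image_image)
  qed
  have rev: "(\<Prod>i<l. f (r i) (\<Union>j<i. r j)) = (\<Prod>i<l. f (s i) (W' i))" for f :: "nat set \<Rightarrow> nat set \<Rightarrow> real"
  proof (subst prod.nat_diff_reindex[symmetric], rule prod.cong[OF refl])
    fix i assume "i \<in> {..<l}"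
    then have "r (l - Suc i) = s i" "(\<Union>j<l - Suc i. r j) = W' i" using rW by (auto simp: r_def)
    then show "f (r (l - Suc i)) (\<Union>j<l - Suc i. r j) = f (s i) (W' i)" by simp
  qed
  have "F = (\<Sum>n<M. \<Prod>i<l. \<bar>gdev k H (r i) n\<bar>)"
    unfolding F_def r_def by (subst prod.nat_diff_reindex) simp
  also have "\<dots> \<le> real M * (\<Prod>i<l. avg_bound (s i) (W' i))"
    using sequential_average[of l r, OF r] rev[of avg_bound] by simp
  finally have F2: "F \<le> real M * (\<Prod>i<l. avg_bound (s i) (W' i))" .
  have U2: "rprod U = (\<Prod>i<l. rprod (s i) / rprod (s i \<inter> W' i))"
    using rprod_Union_telescope[of l r] r rev[of "\<lambda>S W. rprod S / rprod (S \<inter> W)"] rU by simp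
  have U0: "rprod U \<ge> 0" by (rule rprod_nonneg)
  \<comment> \<open>One factor of the square is estimated in the given order, the other in the
    reversed order.\<close>
  have "(F * rprod U)\<^sup>2 = (F * rprod U) * (F * rprod U)" by (simp add: power2_eq_square)
  also have "\<dots> \<le> (real M * (\<Prod>i<l. avg_bound (s i) (W i)) * rprod U) * (real M * (\<Prod>i<l. avg_bound (s i) (W' i)) * rprod U)"
    using F0 F1 F2 U0 by (intro mult_mono mult_right_mono mult_nonneg_nonneg) (auto intro!: prod_nonneg avg_bound_nonneg)
  also have "\<dots> = (real M)\<^sup>2 * (\<Prod>i<l. (rprod (s i) / rprod (s i \<inter> W i) * avg_bound (s i) (W i)) * (rprod (s i) / rprod (s i \<inter> W' i) * avg_bound (s i) (W' i)))"
    unfolding prod.distrib U1[symmetric] U2[symmetric] by (simp add: power2_eq_square)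
  also have "\<dots> \<le> (real M)\<^sup>2 * (\<Prod>i<l. (2 * 2 ^ card (s i))\<^sup>2 * T)"
  proof (intro mult_left_mono prod_mono conjI)
    fix i assume i: "i \<in> {..<l}"
    define e where "e = rprod (s i)"
    define a where "a = rprod (s i \<inter> W i)"
    define b where "b = rprod (s i \<inter> W' i)"
    have si: "s i \<subseteq> P" using s i by auto
    have ab1: "1 \<le> a" "1 \<le> b" "1 \<le> e" "a \<le> e" "b \<le> e" unfolding a_def b_def e_def
      using si by (auto intro!: prod_ge_1_P prod_mono_P)
    \<comment> \<open>By \<open>cover\<close> a prime absent from the earlier sets occurs in a later
      one, which yields \<open>e \<le> a * b\<close>.\<close>
    have "s i \<subseteq> W i \<union> W' i"
    proof
      fix p assume "p \<in> s i"
      then obtain j where "j < l" "j \<noteq> i" "p \<in> s j" using cover i by blast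
      then show "p \<in> W i \<union> W' i" by (cases "j < i") (auto simp: W_def W'_def)
    qed
    then have "s i - s i \<inter> W i \<subseteq> s i \<inter> W' i" by auto
    then have "rprod (s i - s i \<inter> W i) \<le> b" unfolding b_def using si by (intro prod_mono_P) auto
    then have ab: "e \<le> a * b" 
      unfolding e_def using prod_split_P[of "s i \<inter> W i" "s i"] si ab1 by (simp add: a_def)
    have one: "rprod (s i) / rprod (s i \<inter> X) * avg_bound (s i) X \<le> 2 ^ card (s i) * (2 * (max (min e T) (rprod (s i \<inter> X)) / rprod (s i \<inter> X)))" for X
    proof -
      have "rprod (s i) / rprod (s i \<inter> X) * avg_bound (s i) X = 2 ^ card (s i) * (e / rprod (s i \<inter> X) * min 1 ((T ^ k + rprod (s i \<inter> X) ^ k) / e ^ k))"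
        by (simp add: avg_bound_def T e_def)
      also have "\<dots> \<le> 2 ^ card (s i) * (2 * (max (min e T) (rprod (s i \<inter> X)) / rprod (s i \<inter> X)))"
        unfolding e_def using si T k_pos by (intro mult_left_mono local_factor_le prod_ge_1_P prod_mono_P) auto
      finally show ?thesis .
    qed
    have "rprod (s i) / rprod (s i \<inter> W i) * avg_bound (s i) (W i) * (rprod (s i) / rprod (s i \<inter> W' i) * avg_bound (s i) (W' i))
      \<le> (2 ^ card (s i) * (2 * (max (min e T) a / a))) * (2 ^ card (s i) * (2 * (max (min e T) b / b)))"
      unfolding a_def b_def using ab1 T
      by (intro mult_mono[OF one one]) (auto intro!: mult_nonneg_nonneg divide_nonneg_nonneg rprod_nonneg avg_bound_nonneg simp: le_max_iff_disj)
    also have "\<dots> = (2 * 2 ^ card (s i))\<^sup>2 * ((max (min e T) a / a) * (max (min e T) b / b))"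
      by (simp add: power2_eq_square)
    also have "\<dots> \<le> (2 * 2 ^ card (s i))\<^sup>2 * T"
      using ab1 ab T by (intro mult_left_mono local_factor_pair_le) auto
    finally show "rprod (s i) / rprod (s i \<inter> W i) * avg_bound (s i) (W i) * (rprod (s i) / rprod (s i \<inter> W' i) * avg_bound (s i) (W' i)) \<le> (2 * 2 ^ card (s i))\<^sup>2 * T" .
  qed (auto intro!: mult_nonneg_nonneg divide_nonneg_nonneg rprod_nonneg avg_bound_nonneg)
  also have "\<dots> = (real M * (2 ^ l * (\<Prod>i<l. 2 ^ card (s i)) * sqrt T ^ l))\<^sup>2"
  proof -
    have "(\<Prod>i<l. (2 * c i)\<^sup>2 * T) = (2 ^ l * (\<Prod>i<l. c i) * sqrt T ^ l)\<^sup>2" for c :: "nat \<Rightarrow> real"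
    proof (induction l)
      case (Suc l)
      have "sqrt T * sqrt T = T" using T by simp
      then have "(2 * c l)\<^sup>2 * T = (2 * c l * sqrt T)\<^sup>2" by (simp add: power_mult_distrib)
      then show ?case unfolding prod.lessThan_Suc Suc by (simp add: power_mult_distrib)
    qed simp
    then show ?thesis by (simp only: power_mult_distrib[of "real M"])
  qed
  finally have "F * rprod U \<le> real M * (2 ^ l * (\<Prod>i<l. 2 ^ card (s i)) * sqrt T ^ l)"
    by (rule power2_le_imp_le) (use T in \<open>auto intro!: mult_nonneg_nonneg prod_nonneg\<close>)
  moreover have "sqrt T ^ l = real H powr (real l / (2 * real k))"
    using H_pos k_pos by (simp add: T_def powr_half_sqrt[symmetric] powr_powr powr_power field_simps)
  ultimately show ?thesis by (simp add: F_def U_def)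
qed

text \<open>For each shift, everything except the factor \<open>dev k p\<close> inside
  \<open>gdev k H (s i)\<close> is periodic modulo the k-th power of the product of
  \<open>P - {p}\<close>; along a progression with this step \<open>dev k p\<close> averages to
  zero.\<close>

lemma mean_eq_0:
  fixes l :: nat and s :: "nat \<Rightarrow> nat set"
  assumes s: "\<And>i. i < l \<Longrightarrow> s i \<subseteq> P" and i: "i < l" "p \<in> s i" and uniq: "\<And>j. j < l \<Longrightarrow> j \<noteq> i \<Longrightarrow> p \<notin> s j"
  shows "(\<Sum>n<M. \<Prod>j<l. gdev k H (s j) n) = 0"
proof -
  define A where "A = (\<lambda>n. \<Prod>j\<in>{..<l}-{i}. gdev k H (s j) n)"
  let ?B = "gdev k H (s i)" and ?u = "(\<Prod>(P - {p})) ^ k"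
  have u: "q ^ k dvd ?u" if "q \<in> P - {p}" for q 
    using that power_dvd_P[of "P - {p}" ?u] by auto
  have Au: "A (n + ?u) = A n" for n
    unfolding A_def using uniq s by (intro prod.cong refl gdev_periodic u) fastforce
  have AM: "A (n + M) = A n" for n unfolding A_def using s by (intro prod.cong refl gdev_periodic_M) auto
  have BM: "?B (n + M) = ?B n" for n using s i by (intro gdev_periodic_M) auto
  have fin: "finite (s i)" using s i finite_subset_P by blast
  have B0: "(\<Sum>t<M. ?B (n + ?u * t)) = 0" for n
  proof -
    have dq: "dev k q (n + ?u * t + h) = dev k q (n + h)" if "q \<in> s i - {p}" for q t h
    proof -
      have "q \<in> P - {p}" using that s[OF i(1)] by auto
      then have "q ^ k dvd ?u * t" by (intro dvd_mult2 u)
      then have "q ^ k dvd (n + h) + ?u * t \<longleftrightarrow> q ^ k dvd n + h" by (rule dvd_add_left_iff)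
      then show ?thesis unfolding dev_def by (simp add: ac_simps)
    qed
    have "(\<Sum>t<M. ?B (n + ?u * t)) = (\<Sum>h<H. \<Sum>t<M. \<Prod>q\<in>s i. dev k q (n + ?u * t + h))"
      unfolding gdev_def by (rule sum.swap)
    also have "\<dots> = (\<Sum>h<H. (\<Sum>t<M. dev k p ((n + h) + ?u * t)) * (\<Prod>q\<in>s i - {p}. dev k q (n + h)))"
      unfolding sum_distrib_right prod.remove[OF fin i(2)]
      by (intro sum.cong refl arg_cong2[where f="(*)"] prod.cong) (simp only: ac_simps, rule dq)
    also have "\<dots> = 0"
    proof -
      have "p \<in> P" using s i by blast
      then show ?thesis by (simp add: sum_dev_progression)
    qed
    finally show ?thesis .
  qed
  have "real M * (\<Sum>n<M. A n * ?B n) = (\<Sum>n<M. A n * (\<Sum>t<M. ?B (n + ?u * t)))"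
    by (rule sum_periodic_average[of A ?u M ?B, OF Au AM BM])
  also have "\<dots> = 0" by (simp add: B0)
  finally have "(\<Sum>n<M. A n * ?B n) = 0" using M_pos by simp
  moreover have "(\<Prod>j<l. gdev k H (s j) n) = A n * ?B n" for n
    unfolding A_def using i by (subst prod.remove[of _ i]) (auto simp: mult.commute)
  ultimately show ?thesis by simp
qed

section \<open>Sums over initial segments\<close>

lemma mod_eq_prod_power_iff:
  assumes V: "V \<subseteq> P"
  shows "m mod (\<Prod>V) ^ k = n mod (\<Prod>V) ^ k \<longleftrightarrow> (\<forall>p\<in>V. m mod p ^ k = n mod p ^ k)"
proof -
  have "m mod (\<Prod>V) ^ k = n mod (\<Prod>V) ^ k \<longleftrightarrow> (\<forall>p\<in>V. m mod p ^ k = n mod p ^ k)" if "n \<le> m" for m n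
    using that by (simp add: mod_eq_dvd_iff_nat power_dvd_P[OF V])
  then show ?thesis by (metis nat_le_linear)
qed

text \<open>The \<open>n\<close> that count in the product of the
  \<open>cnt k H (\<alpha> i) n\<close> for one fixed choice of shifts \<open>h i\<close>.\<close>

definition sols :: "nat \<Rightarrow> (nat \<Rightarrow> nat set) \<Rightarrow> (nat \<Rightarrow> nat) \<Rightarrow> nat set" where
  "sols l \<alpha> h = {n. \<forall>i<l. \<forall>p\<in>\<alpha> i. p ^ k dvd n + h i}"

text \<open>The conditions may contradict each other. Given one solution \<open>m\<close>, however,
  being a solution means agreeing with \<open>m\<close> modulo every \<open>p ^ k\<close>, hence
  modulo the product of these prime powers.\<close>

lemma sols_residue_class:
  assumes \<alpha>: "\<And>i. i < l \<Longrightarrow> \<alpha> i \<subseteq> P" and ne: "sols l \<alpha> h \<noteq> {}"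
  obtains r where "r < (\<Prod>(\<Union>i<l. \<alpha> i)) ^ k" "sols l \<alpha> h = {n. n mod (\<Prod>(\<Union>i<l. \<alpha> i)) ^ k = r}"
proof -
  define V where "V = (\<Union>i<l. \<alpha> i)"
  have V: "V \<subseteq> P" using \<alpha> by (auto simp: V_def)
  obtain m where m: "m \<in> sols l \<alpha> h" using ne by auto
  have "n \<in> sols l \<alpha> h \<longleftrightarrow> n mod (\<Prod>V) ^ k = m mod (\<Prod>V) ^ k" for n
  proof -
    have "p ^ k dvd n + h i \<longleftrightarrow> n mod p ^ k = m mod p ^ k" if "i < l" "p \<in> \<alpha> i" for i p
    proof -
      have "p ^ k dvd m + h i" using m that by (auto simp: sols_def)
      then have "p ^ k dvd n + h i \<longleftrightarrow> [n + h i = m + h i] (mod p ^ k)"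
        by (metis cong_0_iff cong_sym_eq cong_trans cong_dvd_iff)
      also have "\<dots> \<longleftrightarrow> n mod p ^ k = m mod p ^ k"
        by (simp only: cong_add_rcancel_nat) (simp only: cong_def)
      finally show ?thesis .
    qed
    then show ?thesis unfolding mod_eq_prod_power_iff[OF V] by (auto simp: sols_def V_def)
  qed
  then have "sols l \<alpha> h = {n. n mod (\<Prod>V) ^ k = m mod (\<Prod>V) ^ k}" by auto
  moreover have "m mod (\<Prod>V) ^ k < (\<Prod>V) ^ k" using prod_pos_P[OF V] by simp
  ultimately show thesis using that unfolding V_def by blast
qed

text \<open>Contradictory conditions make all counts zero. Otherwise a single residue class is
  counted, and its number of elements in \<open>{1..N}\<close> differs by at most 1 from
  \<open>N\<close> times its density in a full period.\<close>

lemma card_sols: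
  assumes \<alpha>: "\<And>i. i < l \<Longrightarrow> \<alpha> i \<subseteq> P"
  shows card_sols_approx: "\<bar>real (card {n \<in> {1..N}. n \<in> sols l \<alpha> h}) - real N / real M * real (card {n \<in> {..<M}. n \<in> sols l \<alpha> h})\<bar> \<le> 1"
    and card_sols_le: "real (card {n \<in> {1..N}. n \<in> sols l \<alpha> h}) \<le> real N / rprod (\<Union>i<l. \<alpha> i) ^ k + 1"
proof -
  define V where "V = (\<Union>i<l. \<alpha> i)"
  define q where "q = (\<Prod>V) ^ k"
  have V: "V \<subseteq> P" using \<alpha> by (auto simp: V_def)
  have rq: "rprod V ^ k = real q" by (simp add: rprod_def q_def)
  have q0: "q > 0" using prod_pos_P[OF V] by (simp add: q_def)
  have "q dvd M" unfolding q_def M_def using V finite_P by (intro dvd_power_same prod_dvd_prod_subset) auto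
  then obtain c where c: "M = q * c" by blast
  have "\<bar>real (card {n \<in> {1..N}. n \<in> sols l \<alpha> h}) - real N / real M * real (card {n \<in> {..<M}. n \<in> sols l \<alpha> h})\<bar> \<le> 1 \<and>
     real (card {n \<in> {1..N}. n \<in> sols l \<alpha> h}) \<le> real N / real q + 1"
  proof (cases "sols l \<alpha> h = {}")
    case False
    then obtain r where r: "r < q" "sols l \<alpha> h = {n. n mod q = r}"
      using sols_residue_class[where \<alpha>=\<alpha> and l=l, OF \<alpha>] unfolding q_def V_def by metis
    have I: "{1..N} = {1..<1+N}" by auto
    have 1: "\<bar>real (card {n \<in> {1..N}. n \<in> sols l \<alpha> h}) - real N / real q\<bar> \<le> 1"
      using card_residue_class_approx[OF r(1), of 1 N] unfolding I r(2) by simp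
    have "card {n \<in> {..<M}. n \<in> sols l \<alpha> h} = c"
      using card_residue_class_blocks[OF r(1), of 0 c] by (simp add: c r(2) atLeast0LessThan)
    then have "real N / real M * real (card {n \<in> {..<M}. n \<in> sols l \<alpha> h}) = real N / real q"
      using q0 M_pos c by simp
    then show ?thesis using 1 by linarith
  qed auto
  then show "\<bar>real (card {n \<in> {1..N}. n \<in> sols l \<alpha> h}) - real N / real M * real (card {n \<in> {..<M}. n \<in> sols l \<alpha> h})\<bar> \<le> 1"
    "real (card {n \<in> {1..N}. n \<in> sols l \<alpha> h}) \<le> real N / rprod (\<Union>i<l. \<alpha> i) ^ k + 1"
    using rq by (auto simp: V_def)
qed

lemma sum_prod_cnt:
  assumes \<alpha>: "\<And>i. i < l \<Longrightarrow> \<alpha> i \<subseteq> P" and X: "finite X"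
  shows "(\<Sum>n\<in>X. \<Prod>i<l. cnt k H (\<alpha> i) n) = (\<Sum>h\<in>PiE {..<l} (\<lambda>_. {..<H}). real (card {n \<in> X. n \<in> sols l \<alpha> h}))"
proof -
  have eq: "(\<Prod>i<l. cnt k H (\<alpha> i) n) = (\<Sum>h\<in>PiE {..<l} (\<lambda>_. {..<H}). of_bool (n \<in> sols l \<alpha> h))" for n
  proof -
    have "(\<Prod>i<l. cnt k H (\<alpha> i) n) = (\<Sum>h\<in>PiE {..<l} (\<lambda>_. {..<H}). \<Prod>i<l. of_bool (\<forall>p\<in>\<alpha> i. p ^ k dvd n + h i))"
      unfolding cnt_def by (rule prod_sum_PiE) auto
    then show ?thesis by (simp only: prod_of_bool finite_lessThan sols_def mem_Collect_eq Ball_def lessThan_iff)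
  qed
  have "(\<Sum>n\<in>X. \<Prod>i<l. cnt k H (\<alpha> i) n) = (\<Sum>h\<in>PiE {..<l} (\<lambda>_. {..<H}). \<Sum>n\<in>X. of_bool (n \<in> sols l \<alpha> h))"
    unfolding eq by (rule sum.swap)
  also have "\<dots> = (\<Sum>h\<in>PiE {..<l} (\<lambda>_. {..<H}). real (card {n \<in> X. n \<in> sols l \<alpha> h}))"
    using X by (intro sum.cong refl) (simp add: of_bool_def sum.If_cases Int_def)
  finally show ?thesis .
qed

lemma card_shifts: "real (card (PiE {..<l} (\<lambda>_. {..<H}))) = real H ^ l"
  by (simp add: card_PiE)

lemma sum_prod_cnt_approx:
  assumes \<alpha>: "\<And>i. i < l \<Longrightarrow> \<alpha> i \<subseteq> P"
  shows "\<bar>(\<Sum>n\<in>{1..N}. \<Prod>i<l. cnt k H (\<alpha> i) n) - real N / real M * (\<Sum>n<M. \<Prod>i<l. cnt k H (\<alpha> i) n)\<bar> \<le> real H ^ l"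
proof -
  have "(\<Sum>n\<in>{1..N}. \<Prod>i<l. cnt k H (\<alpha> i) n) - real N / real M * (\<Sum>n<M. \<Prod>i<l. cnt k H (\<alpha> i) n)
    = (\<Sum>h\<in>PiE {..<l} (\<lambda>_. {..<H}). real (card {n \<in> {1..N}. n \<in> sols l \<alpha> h}) - real N / real M * real (card {n \<in> {..<M}. n \<in> sols l \<alpha> h}))"
    using \<alpha> by (subst (1 2) sum_prod_cnt) (auto simp: sum_subtractf sum_distrib_left)
  also have "\<bar>\<dots>\<bar> \<le> (\<Sum>h\<in>PiE {..<l} (\<lambda>_. {..<H}). 1)"
    by (rule order_trans[OF sum_abs], rule sum_mono, rule card_sols_approx[OF \<alpha>])
  also have "\<dots> = real H ^ l" using card_shifts by simp
  finally show ?thesis .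
qed

lemma sum_prod_cnt_le:
  assumes \<alpha>: "\<And>i. i < l \<Longrightarrow> \<alpha> i \<subseteq> P"
  shows "(\<Sum>n\<in>{1..N}. \<Prod>i<l. cnt k H (\<alpha> i) n) \<le> real H ^ l * (real N / rprod (\<Union>i<l. \<alpha> i) ^ k + 1)"
proof -
  have "(\<Sum>n\<in>{1..N}. \<Prod>i<l. cnt k H (\<alpha> i) n) = (\<Sum>h\<in>PiE {..<l} (\<lambda>_. {..<H}). real (card {n \<in> {1..N}. n \<in> sols l \<alpha> h}))"
    using \<alpha> by (rule sum_prod_cnt) auto
  also have "\<dots> \<le> (\<Sum>h\<in>PiE {..<l} (\<lambda>_. {..<H}). real N / rprod (\<Union>i<l. \<alpha> i) ^ k + 1)"
    by (intro sum_mono card_sols_le \<alpha>)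
  also have "\<dots> = real H ^ l * (real N / rprod (\<Union>i<l. \<alpha> i) ^ k + 1)" 
    by (simp only: sum_constant card_shifts)
  finally show ?thesis .
qed

text \<open>When the product is multiplied out over subsets
  \<open>\<alpha> i \<subseteq> s i\<close>, all coefficients have modulus at most 1, and every
  choice of subsets contributes an error of at most 1 for each of the \<open>H ^ l\<close> tuples of
  shifts.\<close>

lemma sum_prod_gdev_approx:
  assumes s: "\<And>i. i < l \<Longrightarrow> s i \<subseteq> P"
  shows "\<bar>(\<Sum>n\<in>{1..N}. \<Prod>i<l. gdev k H (s i) n) - real N / real M * (\<Sum>n<M. \<Prod>i<l. gdev k H (s i) n)\<bar> \<le> (\<Prod>i<l. 2 ^ card (s i)) * real H ^ l"
proof -
  define \<A> where "\<A> = PiE {..<l} (\<lambda>i. Pow (s i))"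
  define c where "c = (\<lambda>\<alpha>. \<Prod>i<l. (-1) ^ (card (s i) - card (\<alpha> i)) / rprod (s i - \<alpha> i) ^ k)"
  have fin: "finite (s i)" if "i < l" for i using s that finite_subset_P by blast
  have expand: "(\<Prod>i<l. gdev k H (s i) n) = (\<Sum>\<alpha>\<in>\<A>. c \<alpha> * (\<Prod>i<l. cnt k H (\<alpha> i) n))" for n
  proof -
    have "(\<Prod>i<l. gdev k H (s i) n) = (\<Prod>i<l. \<Sum>A\<in>Pow (s i). (-1) ^ (card (s i) - card A) / rprod (s i - A) ^ k * cnt k H A n)"
      using s by (intro prod.cong refl gdev_expand) auto
    also have "\<dots> = (\<Sum>\<alpha>\<in>\<A>. c \<alpha> * (\<Prod>i<l. cnt k H (\<alpha> i) n))"
      unfolding \<A>_def c_def prod.distrib[symmetric] using fin by (subst prod_sum_PiE) auto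
    finally show ?thesis .
  qed
  have sw: "(\<Sum>n\<in>X. \<Prod>i<l. gdev k H (s i) n) = (\<Sum>\<alpha>\<in>\<A>. c \<alpha> * (\<Sum>n\<in>X. \<Prod>i<l. cnt k H (\<alpha> i) n))" for X
    unfolding expand sum_distrib_left by (rule sum.swap)
  have "(\<Sum>n\<in>{1..N}. \<Prod>i<l. gdev k H (s i) n) - real N / real M * (\<Sum>n<M. \<Prod>i<l. gdev k H (s i) n)
    = (\<Sum>\<alpha>\<in>\<A>. c \<alpha> * ((\<Sum>n\<in>{1..N}. \<Prod>i<l. cnt k H (\<alpha> i) n) - real N / real M * (\<Sum>n<M. \<Prod>i<l. cnt k H (\<alpha> i) n)))"
  proof -
    have "(\<Sum>\<alpha>\<in>\<A>. c \<alpha> * a \<alpha>) - r * (\<Sum>\<alpha>\<in>\<A>. c \<alpha> * b \<alpha>) = (\<Sum>\<alpha>\<in>\<A>. c \<alpha> * (a \<alpha> - r * b \<alpha>))" for a b r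
      by (simp add: sum_distrib_left sum_subtractf right_diff_distrib mult_ac)
    then show ?thesis unfolding sw .
  qed
  also have "\<bar>\<dots>\<bar> \<le> (\<Sum>\<alpha>\<in>\<A>. real H ^ l)"
  proof (rule order_trans[OF sum_abs], rule sum_mono)
    fix \<alpha> assume "\<alpha> \<in> \<A>"
    then have \<alpha>: "\<alpha> i \<subseteq> s i" "\<alpha> i \<subseteq> P" if "i < l" for i using that s by (auto simp: \<A>_def PiE_iff)
    have "\<bar>c \<alpha>\<bar> = (\<Prod>i<l. 1 / rprod (s i - \<alpha> i) ^ k)"
      unfolding c_def abs_prod by (intro prod.cong refl) (simp add: power_abs rprod_nonneg)
    also have "\<dots> \<le> (\<Prod>i<l. 1)"
    proof (intro prod_mono conjI)
      fix i assume "i \<in> {..<l}"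
      then have "rprod (s i - \<alpha> i) \<ge> 1" using s by (intro prod_ge_1_P) auto
      then show "1 / rprod (s i - \<alpha> i) ^ k \<le> 1" by simp
    qed (simp add: rprod_nonneg)
    finally have "\<bar>c \<alpha>\<bar> \<le> 1" by simp
    then have "\<bar>c \<alpha>\<bar> * \<bar>(\<Sum>n\<in>{1..N}. \<Prod>i<l. cnt k H (\<alpha> i) n) - real N / real M * (\<Sum>n<M. \<Prod>i<l. cnt k H (\<alpha> i) n)\<bar> \<le> 1 * real H ^ l"
      by (intro mult_mono sum_prod_cnt_approx \<alpha>) auto
    then show "\<bar>c \<alpha> * ((\<Sum>n\<in>{1..N}. \<Prod>i<l. cnt k H (\<alpha> i) n) - real N / real M * (\<Sum>n<M. \<Prod>i<l. cnt k H (\<alpha> i) n))\<bar> \<le> real H ^ l"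
      by (simp add: abs_mult)
  qed
  also have "\<dots> = (\<Prod>i<l. 2 ^ card (s i)) * real H ^ l"
    using fin by (simp add: \<A>_def card_PiE card_Pow)
  finally show ?thesis .
qed

lemma small_tuple_bound:
  assumes s: "\<And>i. i < l \<Longrightarrow> s i \<subseteq> P \<and> s i \<noteq> {}"
  defines "U \<equiv> \<Union>i<l. s i"
  shows "\<bar>\<Sum>n\<in>{1..N}. \<Prod>i<l. gdev k H (s i) n\<bar> \<le> (2 ^ l) ^ card U * (2 ^ l * real H powr (real l / (2 * real k)) * real N / rprod U + real H ^ l)"
proof -
  have U: "U \<subseteq> P" using s by (auto simp: U_def)
  have U1: "rprod U \<ge> 1" using U by (rule prod_ge_1_P)
  \<comment> \<open>Every \<open>s i\<close> lies in \<open>U\<close>, so the factor can be made to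
    depend on the tuple only through its union.\<close>
  have "(\<Prod>i<l. 2 ^ card (s i)) \<le> (\<Prod>i<l. (2::real) ^ card U)"
    using finite_subset_P[OF U] by (intro prod_mono conjI power_increasing card_mono) (auto simp: U_def)
  also have "\<dots> = (2 ^ l) ^ card U" by (simp flip: power_mult add: mult.commute)
  finally have c: "(\<Prod>i<l. 2 ^ card (s i)) \<le> ((2::real) ^ l) ^ card U" .
  let ?E = "\<Sum>n<M. \<Prod>i<l. gdev k H (s i) n"
  have E: "\<bar>?E\<bar> * rprod U \<le> real M * (2 ^ l * (2 ^ l) ^ card U * real H powr (real l / (2 * real k)))"
  \<comment> \<open>Either some prime lies in only one of the sets and the mean vanishes, or every
    prime recurs, which is the hypothesis \<open>cover\<close> of \<open>mean_bound\<close>.\<close>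
  proof (cases "\<exists>i<l. \<exists>p\<in>s i. \<forall>j<l. j \<noteq> i \<longrightarrow> p \<notin> s j")
    case True
    then have "?E = 0" using mean_eq_0[of l s] s by metis
    then show ?thesis by simp
  next
    case False
    have "\<bar>?E\<bar> \<le> (\<Sum>n<M. \<Prod>i<l. \<bar>gdev k H (s i) n\<bar>)"
      by (rule order_trans[OF sum_abs]) (simp add: abs_prod)
    then have "\<bar>?E\<bar> * rprod U \<le> (\<Sum>n<M. \<Prod>i<l. \<bar>gdev k H (s i) n\<bar>) * rprod U"
      by (intro mult_right_mono rprod_nonneg)
    also have "\<dots> \<le> real M * (2 ^ l * (\<Prod>i<l. 2 ^ card (s i)) * real H powr (real l / (2 * real k)))"
      unfolding U_def using False s by (intro mean_bound) blast+
    also have "\<dots> \<le> real M * (2 ^ l * (2 ^ l) ^ card U * real H powr (real l / (2 * real k)))"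
      using c by (intro mult_left_mono mult_right_mono) auto
    finally show ?thesis .
  qed
  have "real N / real M * \<bar>?E\<bar> = real N / (real M * rprod U) * (\<bar>?E\<bar> * rprod U)"
    using U1 by simp
  also have "\<dots> \<le> real N / (real M * rprod U) * (real M * (2 ^ l * (2 ^ l) ^ card U * real H powr (real l / (2 * real k))))"
    using E U1 by (intro mult_left_mono) auto
  also have "\<dots> = (2 ^ l) ^ card U * (2 ^ l * real H powr (real l / (2 * real k)) * real N / rprod U)"
    using M_pos U1 by (simp add: field_simps)
  finally have 1: "\<bar>real N / real M * ?E\<bar> \<le> (2 ^ l) ^ card U * (2 ^ l * real H powr (real l / (2 * real k)) * real N / rprod U)"
    by (simp add: abs_mult)
  have "\<bar>(\<Sum>n\<in>{1..N}. \<Prod>i<l. gdev k H (s i) n) - real N / real M * ?E\<bar> \<le> (\<Prod>i<l. 2 ^ card (s i)) * real H ^ l"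
    using s by (intro sum_prod_gdev_approx) auto
  also have "\<dots> \<le> (2 ^ l) ^ card U * real H ^ l"
    using c by (intro mult_right_mono) auto
  finally have 2: "\<bar>(\<Sum>n\<in>{1..N}. \<Prod>i<l. gdev k H (s i) n) - real N / real M * ?E\<bar> \<le> (2 ^ l) ^ card U * real H ^ l" .
  have "\<bar>a\<bar> \<le> x + z" if "\<bar>a - b\<bar> \<le> z" "\<bar>b\<bar> \<le> x" for a b x z :: real using that by linarith
  from this[OF 2 1] show ?thesis by (simp only: distrib_left)
qed

end

section \<open>Summation over tuples\<close>

text \<open>The deviation obtained by sieving with the primes of \<open>P\<close> only; a finite
  Euler product takes the place of the inverse zeta value.\<close>

definition D_trunc :: "nat set \<Rightarrow> nat \<Rightarrow> nat \<Rightarrow> nat \<Rightarrow> real" where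
  "D_trunc P k H n = (\<Sum>h<H. \<Prod>p\<in>P. 1 - of_bool (p ^ k dvd n + h)) - real H * (\<Prod>p\<in>P. 1 - 1 / real p ^ k)"

text \<open>The constants \<open>C\<close> and \<open>Z\<close> are those of
  \<open>power_card_primes_le\<close> and \<open>sum_rprod_powr_le\<close>. The base
  \<open>4 ^ l\<close> combines the \<open>2 ^ l\<close> of \<open>small_tuple_bound\<close> with
  the \<open>2 ^ l\<close> that counts the tuples with a given union.\<close>

locale bounded_family = prime_family +
  fixes l N :: nat and \<delta> C Z :: real
  assumes k_ge_2: "k \<ge> 2" and l_pos: "l \<ge> 1" and N_pos: "N \<ge> 1"
    and \<delta>: "0 < \<delta>" "\<delta> \<le> 1 / 3" and C1: "C \<ge> 1" and Z1: "Z \<ge> 1"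
    and C: "\<And>U. U \<subseteq> P \<Longrightarrow> (4 ^ l) ^ card U \<le> C * rprod U powr \<delta>"
    and Z: "(\<Sum>U\<in>Pow P. rprod U powr - (1 + \<delta>)) \<le> Z"
begin

text \<open>The exponent is chosen to give \<open>N_times_y\<close>: products beyond
  \<open>y\<close>, summed by Rankin's trick, then cost as much as the error terms for products up
  to y^2.\<close>

definition y :: real where "y = real N powr (1 / (real k + 1))"

abbreviation tuples :: "(nat \<Rightarrow> nat set) set" where "tuples \<equiv> PiE {..<l} (\<lambda>_. Pow P)"

lemma y_ge_1: "y \<ge> 1"
  unfolding y_def using N_pos by (intro ge_one_powr_ge_zero) auto

lemma y_le_N: "y \<le> real N"
  unfolding y_def using N_pos powr_mono[of "1 / (real k + 1)" 1 "real N"] by simp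

lemma N_eq_y: "real N = y powr (real k + 1)"
  unfolding y_def using N_pos by (simp add: powr_powr)

lemma N_times_y: "real N * y powr (1 - real k) = y\<^sup>2"
proof -
  have "real N * y powr (1 - real k) = y powr 2"
    unfolding N_eq_y by (simp flip: powr_add)
  then show ?thesis using y_ge_1 by (simp add: powr_numeral)
qed

lemma finite_tuples: "finite tuples"
  using finite_P by (intro finite_PiE) auto

lemma tuplesD: "s \<in> tuples \<Longrightarrow> i < l \<Longrightarrow> s i \<subseteq> P"
  by (auto simp: PiE_iff)

lemma tuples_Union: "s \<in> tuples \<Longrightarrow> (\<Union>i<l. s i) \<subseteq> P"
  by (auto simp: PiE_iff)

lemma rprod_Un_le:
  assumes "A \<subseteq> P" "B \<subseteq> P"
  shows "rprod (A \<union> B) \<le> rprod A * rprod B"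
proof -
  have "rprod (A \<union> B) = rprod A * rprod (B - A)"
    using prod_split_P[of A "A \<union> B"] assms by (simp add: Un_Diff)
  also have "\<dots> \<le> rprod A * rprod B"
    using assms by (intro mult_left_mono prod_mono_P rprod_nonneg) auto
  finally show ?thesis .
qed

lemma rprod_UN_le:
  fixes m :: nat
  assumes "\<And>i. i < m \<Longrightarrow> s i \<subseteq> P"
  shows "rprod (\<Union>i<m. s i) \<le> (\<Prod>i<m. rprod (s i))"
  using assms
proof (induction m)
  case (Suc m)
  have "rprod ((\<Union>i<m. s i) \<union> s m) \<le> rprod (\<Union>i<m. s i) * rprod (s m)"
    using Suc.prems by (intro rprod_Un_le) (auto simp: less_Suc_eq)
  also have "\<dots> \<le> (\<Prod>i<m. rprod (s i)) * rprod (s m)"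
    using Suc by (intro mult_right_mono rprod_nonneg) auto
  finally show ?case by (simp add: lessThan_Suc Un_commute mult.commute)
qed (simp add: rprod_def)

text \<open>All components of a tuple with union \<open>U\<close> are subsets of \<open>U\<close>,
  which leaves \<open>2 ^ card U\<close> choices for each.\<close>

lemma sum_tuples_Union_le:
  fixes \<phi> :: "nat set \<Rightarrow> real"
  assumes "\<And>U. \<phi> U \<ge> 0"
  shows "(\<Sum>s\<in>tuples. \<phi> (\<Union>i<l. s i)) \<le> (\<Sum>U\<in>Pow P. (2 ^ l) ^ card U * \<phi> U)"
proof -
  have "(\<Sum>s\<in>tuples. \<phi> (\<Union>i<l. s i)) = (\<Sum>U\<in>Pow P. \<Sum>s\<in>{s\<in>tuples. (\<Union>i<l. s i) = U}. \<phi> (\<Union>i<l. s i))"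
    using finite_P finite_tuples tuples_Union by (intro sum.group[symmetric]) auto
  also have "\<dots> \<le> (\<Sum>U\<in>Pow P. (2 ^ l) ^ card U * \<phi> U)"
  proof (rule sum_mono)
    fix U assume "U \<in> Pow P"
    then have fin: "finite U" using finite_subset_P by auto
    have "{s\<in>tuples. (\<Union>i<l. s i) = U} \<subseteq> PiE {..<l} (\<lambda>_. Pow U)"
      by (auto intro!: PiE_I intro: PiE_arb)
    then have "card {s\<in>tuples. (\<Union>i<l. s i) = U} \<le> card (PiE {..<l} (\<lambda>_. Pow U))"
      using fin by (intro card_mono finite_PiE) auto
    also have "\<dots> = (2 ^ l) ^ card U" using fin by (simp add: card_PiE card_Pow flip: power_mult)
    finally have "real (card {s\<in>tuples. (\<Union>i<l. s i) = U}) \<le> real ((2 ^ l) ^ card U)" by (rule of_nat_mono)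
    then have "real (card {s\<in>tuples. (\<Union>i<l. s i) = U}) * \<phi> U \<le> (2 ^ l) ^ card U * \<phi> U"
      using assms by (intro mult_right_mono) auto
    moreover have "(\<Sum>s\<in>{s\<in>tuples. (\<Union>i<l. s i) = U}. \<phi> (\<Union>i<l. s i)) = (\<Sum>s\<in>{s\<in>tuples. (\<Union>i<l. s i) = U}. \<phi> U)"
      by (intro sum.cong) auto
    ultimately show "(\<Sum>s\<in>{s\<in>tuples. (\<Union>i<l. s i) = U}. \<phi> (\<Union>i<l. s i)) \<le> (2 ^ l) ^ card U * \<phi> U" by simp
  qed
  finally show ?thesis .
qed

text \<open>Rankin's trick: with \<open>e = rprod U\<close>, the term is at most C e^(2\<delta>) (a
  + b e) e^-(1+\<delta>). The part before the last power grows with \<open>e\<close> and is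
  estimated at \<open>Q\<close>; the last power is summable.\<close>

lemma sum_weighted_le:
  assumes "a \<ge> 0" "b \<ge> 0" "Q \<ge> 1"
  shows "(\<Sum>U\<in>Pow P. if rprod U \<le> Q then (4 ^ l) ^ card U * (a / rprod U + b) else 0) \<le> C * Z * Q powr (2 * \<delta>) * (a + b * Q)"
proof -
  have "(\<Sum>U\<in>Pow P. if rprod U \<le> Q then (4 ^ l) ^ card U * (a / rprod U + b) else 0)
      \<le> (\<Sum>U\<in>Pow P. C * Q powr (2 * \<delta>) * (a + b * Q) * rprod U powr - (1 + \<delta>))"
  proof (rule sum_mono)
    fix U assume "U \<in> Pow P"
    then have U: "U \<subseteq> P" by auto
    define e where "e = rprod U"
    have e: "e \<ge> 1" using prod_ge_1_P[OF U] by (simp add: e_def)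
    show "(if rprod U \<le> Q then (4 ^ l) ^ card U * (a / rprod U + b) else 0) \<le> C * Q powr (2 * \<delta>) * (a + b * Q) * rprod U powr - (1 + \<delta>)"
    proof (cases "e \<le> Q")
      case True
      have "(4 ^ l) ^ card U * (a / e + b) \<le> C * e powr \<delta> * (a / e + b)"
        using C[OF U] assms e by (intro mult_right_mono) (auto simp: e_def)
      also have "\<dots> = C * (e powr (2 * \<delta>) * (a + b * e)) * e powr - (1 + \<delta>)"
      proof -
        have "e powr \<delta> = e powr (2 * \<delta>) * e powr 1 * e powr - (1 + \<delta>)" unfolding powr_add[symmetric] by simp
        then have "e powr \<delta> = e powr (2 * \<delta>) * e * e powr - (1 + \<delta>)" using e by simp
        then show ?thesis using e by (simp add: field_simps)
      qed
      also have "\<dots> \<le> C * (Q powr (2 * \<delta>) * (a + b * Q)) * e powr - (1 + \<delta>)"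
        using C1 \<delta> e True assms 
        by (intro mult_right_mono mult_left_mono mult_mono powr_mono2 add_left_mono) auto
      finally show ?thesis using True by (simp add: e_def mult_ac)
    next
      case False
      then show ?thesis using C1 assms by (auto simp: e_def)
    qed
  qed
  also have "\<dots> = C * Q powr (2 * \<delta>) * (a + b * Q) * (\<Sum>U\<in>Pow P. rprod U powr - (1 + \<delta>))"
    by (rule sum_distrib_left[symmetric])
  also have "\<dots> \<le> C * Q powr (2 * \<delta>) * (a + b * Q) * Z"
    using Z C1 assms by (intro mult_left_mono) auto
  finally show ?thesis by (simp add: mult_ac)
qed

lemma sum_tuples_weighted_le:
  assumes "a \<ge> 0" "b \<ge> 0" "Q \<ge> 1"
  shows "(\<Sum>s\<in>tuples. if rprod (\<Union>i<l. s i) \<le> Q then (2 ^ l) ^ card (\<Union>i<l. s i) * (a / rprod (\<Union>i<l. s i) + b) else 0) \<le> C * Z * Q powr (2 * \<delta>) * (a + b * Q)"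
proof -
  have "(\<Sum>s\<in>tuples. if rprod (\<Union>i<l. s i) \<le> Q then (2 ^ l) ^ card (\<Union>i<l. s i) * (a / rprod (\<Union>i<l. s i) + b) else 0)
     \<le> (\<Sum>U\<in>Pow P. (2 ^ l) ^ card U * (if rprod U \<le> Q then (2 ^ l) ^ card U * (a / rprod U + b) else 0))"
    using assms 
    by (intro sum_tuples_Union_le[of "\<lambda>U. if rprod U \<le> Q then (2 ^ l) ^ card U * (a / rprod U + b) else 0"]) (simp add: rprod_nonneg)
  also have "\<dots> = (\<Sum>U\<in>Pow P. if rprod U \<le> Q then (4 ^ l) ^ card U * (a / rprod U + b) else 0)"
  proof (intro sum.cong refl)
    fix U :: "nat set"
    have "(2 ^ l) ^ card U * (2 ^ l) ^ card U = ((4::real) ^ l) ^ card U"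
      by (simp flip: power_mult_distrib)
    then show "(2 ^ l) ^ card U * (if rprod U \<le> Q then (2 ^ l) ^ card U * (a / rprod U + b) else 0) = (if rprod U \<le> Q then (4 ^ l) ^ card U * (a / rprod U + b) else 0)"
      by (auto simp flip: mult.assoc)
  qed
  also have "\<dots> \<le> C * Z * Q powr (2 * \<delta>) * (a + b * Q)" by (rule sum_weighted_le[OF assms])
  finally show ?thesis .
qed

text \<open>After splitting off the summable power e^-(1+\<delta>), the remaining exponent
  \<open>\<delta> + (1 - real k)\<close> is negative, so that part may be estimated at
  \<open>y\<close>.\<close>

lemma powr_tail:
  assumes "e > y"
  shows "1 / e ^ k \<le> y powr (\<delta> + (1 - real k)) * e powr - (1 + \<delta>)"
proof -
  have e: "e > 0" using assms y_ge_1 by linarith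
  have "1 / e ^ k = e powr - real k" using e by (simp add: powr_minus powr_realpow divide_inverse)
  also have "\<dots> = e powr (\<delta> + (1 - real k)) * e powr - (1 + \<delta>)" by (simp flip: powr_add)
  also have "e powr (\<delta> + (1 - real k)) \<le> y powr (\<delta> + (1 - real k))"
    using assms y_ge_1 \<delta> k_ge_2 by (intro powr_mono2') auto
  finally show ?thesis by (auto simp: mult_right_mono)
qed

lemma sum_singles_tail: "(\<Sum>A\<in>{A\<in>Pow P. rprod A > y}. 1 / rprod A ^ k) \<le> Z * y powr (\<delta> + (1 - real k))"
proof -
  have "(\<Sum>A\<in>{A\<in>Pow P. rprod A > y}. 1 / rprod A ^ k) \<le> (\<Sum>A\<in>{A\<in>Pow P. rprod A > y}. y powr (\<delta> + (1 - real k)) * rprod A powr - (1 + \<delta>))"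
    by (intro sum_mono powr_tail) auto
  also have "\<dots> \<le> (\<Sum>A\<in>Pow P. y powr (\<delta> + (1 - real k)) * rprod A powr - (1 + \<delta>))"
    using finite_P by (intro sum_mono2) auto
  also have "\<dots> \<le> y powr (\<delta> + (1 - real k)) * Z"
    using Z by (subst sum_distrib_left[symmetric]) (intro mult_left_mono, auto)
  finally show ?thesis by (simp add: mult.commute)
qed

lemma sum_tuples_rankin: "(\<Sum>\<beta>\<in>tuples. \<Prod>i<l. rprod (\<beta> i) powr - (1 + \<delta>)) \<le> Z ^ l"
proof -
  have "(\<Sum>\<beta>\<in>tuples. \<Prod>i<l. rprod (\<beta> i) powr - (1 + \<delta>)) = (\<Prod>i<l. \<Sum>B\<in>Pow P. rprod B powr - (1 + \<delta>))"
    using finite_P by (intro prod_sum_PiE[symmetric]) auto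
  also have "\<dots> \<le> Z ^ l" using Z by (simp add: power_mono sum_nonneg)
  finally show ?thesis .
qed

text \<open>The size of the mean parts contributed by the primes of the \<open>\<beta> i\<close>; it
  is applied to \<open>\<beta> i = s i - \<alpha> i\<close>.\<close>

definition wt :: "(nat \<Rightarrow> nat set) \<Rightarrow> real" where
  "wt \<beta> = (\<Prod>i<l. 1 / rprod (\<beta> i) ^ k)"

lemma wt_nonneg: "wt \<beta> \<ge> 0"
  by (simp add: wt_def prod_nonneg rprod_nonneg)

lemma sum_wt: "(\<Sum>\<beta>\<in>tuples. wt \<beta>) \<le> Z ^ l"
proof -
  have "(\<Sum>\<beta>\<in>tuples. wt \<beta>) \<le> (\<Sum>\<beta>\<in>tuples. \<Prod>i<l. rprod (\<beta> i) powr - (1 + \<delta>))"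
    unfolding wt_def
  proof (intro sum_mono prod_mono conjI)
    fix \<beta> i assume "\<beta> \<in> tuples" "i \<in> {..<l}"
    then have "rprod (\<beta> i) \<ge> 1" using tuplesD by (intro prod_ge_1_P) auto
    then have "1 / rprod (\<beta> i) ^ k = rprod (\<beta> i) powr - real k"
      by (simp add: powr_minus powr_realpow divide_inverse)
    moreover have "rprod (\<beta> i) powr - real k \<le> rprod (\<beta> i) powr - (1 + \<delta>)"
      using k_ge_2 \<delta> \<open>rprod (\<beta> i) \<ge> 1\<close> by (intro powr_mono) auto
    ultimately show "1 / rprod (\<beta> i) ^ k \<le> rprod (\<beta> i) powr - (1 + \<delta>)" by simp
  qed (simp add: rprod_nonneg)
  then show ?thesis using sum_tuples_rankin by linarith
qed

lemma sum_wt_tail: "(\<Sum>\<beta>\<in>{\<beta>\<in>tuples. (\<Prod>i<l. rprod (\<beta> i)) > y}. wt \<beta>) \<le> Z ^ l * y powr (\<delta> + (1 - real k))"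
proof -
  have "(\<Sum>\<beta>\<in>{\<beta>\<in>tuples. (\<Prod>i<l. rprod (\<beta> i)) > y}. wt \<beta>) \<le> (\<Sum>\<beta>\<in>{\<beta>\<in>tuples. (\<Prod>i<l. rprod (\<beta> i)) > y}. y powr (\<delta> + (1 - real k)) * (\<Prod>i<l. rprod (\<beta> i) powr - (1 + \<delta>)))"
  proof (rule sum_mono)
    fix \<beta> assume "\<beta> \<in> {\<beta>\<in>tuples. (\<Prod>i<l. rprod (\<beta> i)) > y}"
    then have "(\<Prod>i<l. rprod (\<beta> i)) > y" by auto
    from powr_tail[OF this] show "wt \<beta> \<le> y powr (\<delta> + (1 - real k)) * (\<Prod>i<l. rprod (\<beta> i) powr - (1 + \<delta>))"
      by (simp add: wt_def prod_dividef prod_power_distrib prod_powr_distrib rprod_nonneg)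
  qed
  also have "\<dots> \<le> (\<Sum>\<beta>\<in>tuples. y powr (\<delta> + (1 - real k)) * (\<Prod>i<l. rprod (\<beta> i) powr - (1 + \<delta>)))"
    using finite_tuples by (intro sum_mono2) (auto intro!: mult_nonneg_nonneg prod_nonneg)
  also have "\<dots> \<le> y powr (\<delta> + (1 - real k)) * Z ^ l"
    using sum_tuples_rankin by (subst sum_distrib_left[symmetric]) (intro mult_left_mono, auto)
  finally show ?thesis by (simp add: mult.commute)
qed

section \<open>Rare integers with divisibility conditions of large product\<close>

definition exceptional :: "(nat \<Rightarrow> nat) \<Rightarrow> nat set" where
  "exceptional h = {n \<in> {1..N}. \<exists>\<alpha>\<in>tuples. n \<in> sols l \<alpha> h \<and> rprod (\<Union>i<l. \<alpha> i) > y}"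

text \<open>When the sets are added one at a time, the product over the union first exceeds
  \<open>y\<close> after \<open>j\<close> sets. Before the last of them it was at most
  \<open>y\<close>, and that set itself has product at most \<open>y\<close>.\<close>

lemma truncate_tuple:
  assumes \<alpha>: "\<alpha> \<in> tuples" and big: "rprod (\<Union>i<l. \<alpha> i) > y" and single: "\<And>i. i < l \<Longrightarrow> rprod (\<alpha> i) \<le> y"
    and n: "n \<in> sols l \<alpha> h"
  obtains \<alpha>' where "\<alpha>' \<in> tuples" "n \<in> sols l \<alpha>' h" "rprod (\<Union>i<l. \<alpha>' i) > y" "rprod (\<Union>i<l. \<alpha>' i) \<le> y\<^sup>2"
proof -
  define j where "j = (LEAST j. rprod (\<Union>i<j. \<alpha> i) > y)"
  have j: "rprod (\<Union>i<j. \<alpha> i) > y" unfolding j_def using big by (rule LeastI)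
  have jl: "j \<le> l" unfolding j_def using big by (rule Least_le)
  have "j \<noteq> 0"
  proof
    assume "j = 0"
    then show False using j y_ge_1 by (simp add: rprod_def)
  qed
  then obtain m where m: "j = Suc m" by (cases j) auto
  have "\<not> rprod (\<Union>i<m. \<alpha> i) > y" 
    using not_less_Least[of m "\<lambda>j. rprod (\<Union>i<j. \<alpha> i) > y", folded j_def] m by simp
  then have small: "rprod (\<Union>i<m. \<alpha> i) \<le> y" by simp
  \<comment> \<open>Emptying the later sets only drops conditions, so \<open>n\<close> remains a
    solution.\<close>
  define \<alpha>' where "\<alpha>' = (\<lambda>i\<in>{..<l}. if i < j then \<alpha> i else {})"
  have Un: "(\<Union>i<l. \<alpha>' i) = (\<Union>i<j. \<alpha> i)" using jl by (force simp: \<alpha>'_def split: if_splits)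
  have sub: "\<alpha> i \<subseteq> P" if "i < l" for i using tuplesD[OF \<alpha> that] .
  have "rprod (\<Union>i<j. \<alpha> i) = rprod ((\<Union>i<m. \<alpha> i) \<union> \<alpha> m)" unfolding m by (simp add: lessThan_Suc Un_commute)
  also have "\<dots> \<le> rprod (\<Union>i<m. \<alpha> i) * rprod (\<alpha> m)"
    using sub m jl by (intro rprod_Un_le UN_least) auto
  also have "\<dots> \<le> y * y" using small single m jl y_ge_1 by (intro mult_mono rprod_nonneg) auto
  finally have "rprod (\<Union>i<j. \<alpha> i) \<le> y\<^sup>2" by (simp add: power2_eq_square)
  moreover have "\<alpha>' \<in> tuples" using sub by (auto simp: \<alpha>'_def)
  moreover have "n \<in> sols l \<alpha>' h" using n by (auto simp: sols_def \<alpha>'_def)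
  ultimately show thesis using that[of \<alpha>'] Un j by simp
qed

text \<open>\<open>E1\<close> collects the \<open>n\<close> with a single set of conditions of
  product above \<open>y\<close>; \<open>E2\<close> collects those with a tuple of product above
  \<open>y\<close> and at most y^2, to which \<open>truncate_tuple\<close> reduces the remaining
  case.\<close>

lemma card_exceptional_le:
  assumes h: "\<And>i. i < l \<Longrightarrow> h i \<le> N"
  shows "real (card (exceptional h)) \<le> (2 * real l + 2 * C) * Z * y powr (4 * \<delta>) * y\<^sup>2"
proof -
  define \<S> where "\<S> = {A\<in>Pow P. rprod A > y}"
  define \<T> where "\<T> = {\<alpha>\<in>tuples. rprod (\<Union>i<l. \<alpha> i) > y \<and> rprod (\<Union>i<l. \<alpha> i) \<le> y\<^sup>2}"
  define E1 where "E1 = (\<Union>i<l. \<Union>A\<in>\<S>. {n\<in>{1..N}. (\<Prod>A) ^ k dvd n + h i})"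
  define E2 where "E2 = (\<Union>\<alpha>\<in>\<T>. {n\<in>{1..N}. n \<in> sols l \<alpha> h})"
  have fin: "finite \<S>" "finite \<T>" using finite_P finite_tuples by (auto simp: \<S>_def \<T>_def)
  have "exceptional h \<subseteq> E1 \<union> E2"
  proof
    fix n assume "n \<in> exceptional h"
    then obtain \<alpha> where n: "n \<in> {1..N}" and \<alpha>: "\<alpha> \<in> tuples" "n \<in> sols l \<alpha> h" "rprod (\<Union>i<l. \<alpha> i) > y"
      by (auto simp: exceptional_def)
    show "n \<in> E1 \<union> E2"
    proof (cases "\<exists>i<l. rprod (\<alpha> i) > y")
      case True
      then obtain i where i: "i < l" "rprod (\<alpha> i) > y" by auto
      have "\<alpha> i \<subseteq> P" using tuplesD[OF \<alpha>(1) i(1)] .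
      moreover from this have "(\<Prod>(\<alpha> i)) ^ k dvd n + h i" using \<alpha>(2) i by (subst power_dvd_P) (auto simp: sols_def)
      ultimately have "n \<in> E1" unfolding E1_def \<S>_def using i n by blast
      then show ?thesis ..
    next
      case False
      then obtain \<alpha>' where "\<alpha>' \<in> tuples" "n \<in> sols l \<alpha>' h" "rprod (\<Union>i<l. \<alpha>' i) > y" "rprod (\<Union>i<l. \<alpha>' i) \<le> y\<^sup>2"
        using truncate_tuple[OF \<alpha>(1,3) _ \<alpha>(2)] by (metis not_le)
      then have "n \<in> E2" unfolding E2_def \<T>_def using n by blast
      then show ?thesis ..
    qed
  qed
  then have "card (exceptional h) \<le> card (E1 \<union> E2)"
    by (intro card_mono) (auto simp: E1_def E2_def fin)
  also have "\<dots> \<le> card E1 + card E2" by (rule card_Un_le)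
  finally have tot: "real (card (exceptional h)) \<le> real (card E1) + real (card E2)" by linarith
  \<comment> \<open>The exponent \<delta> is enlarged to 4 \<delta>, the one that arises for
    \<open>E2\<close>.\<close>
  have Y: "y powr (\<delta> + (1 - real k)) \<le> y powr (4 * \<delta>) * y powr (1 - real k)"
    unfolding powr_add[symmetric] using y_ge_1 \<delta> by (intro powr_mono) auto
  have "card E1 \<le> (\<Sum>i<l. \<Sum>A\<in>\<S>. card {n\<in>{1..N}. (\<Prod>A) ^ k dvd n + h i})"
    unfolding E1_def by (rule order_trans[OF card_UN_le sum_mono]) (auto intro!: card_UN_le fin)
  then have "real (card E1) \<le> real (\<Sum>i<l. \<Sum>A\<in>\<S>. card {n\<in>{1..N}. (\<Prod>A) ^ k dvd n + h i})" by (rule of_nat_mono)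
  also have "\<dots> = (\<Sum>i<l. \<Sum>A\<in>\<S>. real (card {n\<in>{1..N}. (\<Prod>A) ^ k dvd n + h i}))" by simp
  also have "\<dots> \<le> (\<Sum>i<l. \<Sum>A\<in>\<S>. 2 * real N * (1 / rprod A ^ k))"
  proof (intro sum_mono)
    fix i A assume "i \<in> {..<l}" "A \<in> \<S>"
    then have "\<Prod>A > 0" "h i \<le> N" using prod_pos_P[of A] h by (auto simp: \<S>_def)
    then show "real (card {n\<in>{1..N}. (\<Prod>A) ^ k dvd n + h i}) \<le> 2 * real N * (1 / rprod A ^ k)"
      using card_multiples_le[of "(\<Prod>A) ^ k" "h i" N] by (simp add: rprod_def)
  qed
  also have "\<dots> = real l * (2 * real N * (\<Sum>A\<in>\<S>. 1 / rprod A ^ k))" 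
    unfolding sum_distrib_left[symmetric] by simp
  also have "\<dots> \<le> real l * (2 * real N * (Z * (y powr (4 * \<delta>) * y powr (1 - real k))))"
    using sum_singles_tail Y Z1 unfolding \<S>_def
    by (intro mult_left_mono order_trans[OF sum_singles_tail]) auto
  also have "\<dots> = 2 * real l * Z * y powr (4 * \<delta>) * (real N * y powr (1 - real k))" by (simp only: mult_ac)
  finally have 1: "real (card E1) \<le> 2 * real l * Z * y powr (4 * \<delta>) * y\<^sup>2" unfolding N_times_y .
  have "card E2 \<le> (\<Sum>\<alpha>\<in>\<T>. card {n\<in>{1..N}. n \<in> sols l \<alpha> h})"
    unfolding E2_def by (intro card_UN_le fin)
  then have "real (card E2) \<le> real (\<Sum>\<alpha>\<in>\<T>. card {n\<in>{1..N}. n \<in> sols l \<alpha> h})" by (rule of_nat_mono)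
  also have "\<dots> = (\<Sum>\<alpha>\<in>\<T>. real (card {n\<in>{1..N}. n \<in> sols l \<alpha> h}))" by simp
  also have "\<dots> \<le> (\<Sum>\<alpha>\<in>\<T>. (if rprod (\<Union>i<l. \<alpha> i) \<le> y\<^sup>2 then (2 ^ l) ^ card (\<Union>i<l. \<alpha> i) * (y\<^sup>2 / rprod (\<Union>i<l. \<alpha> i) + 1) else 0))"
  proof (rule sum_mono)
    fix \<alpha> assume "\<alpha> \<in> \<T>"
    then have \<alpha>: "\<alpha> \<in> tuples" "rprod (\<Union>i<l. \<alpha> i) > y" "rprod (\<Union>i<l. \<alpha> i) \<le> y\<^sup>2" by (auto simp: \<T>_def)
    define e where "e = rprod (\<Union>i<l. \<alpha> i)"
    have e: "e > y" "e > 0" using \<alpha> y_ge_1 by (auto simp: e_def)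
    have "real (card {n\<in>{1..N}. n \<in> sols l \<alpha> h}) \<le> real N / e ^ k + 1"
      unfolding e_def using tuplesD[OF \<alpha>(1)] by (intro card_sols_le)
    \<comment> \<open>One factor \<open>e\<close> is kept for the summation; the other k - 1 are
      estimated by \<open>e > y\<close>.\<close>
    also have "real N / e ^ k \<le> y\<^sup>2 / e"
    proof -
      have "y powr (real k - 1) \<le> e powr (real k - 1)" using e y_ge_1 k_ge_2 by (intro powr_mono2) auto
      also have "\<dots> = e ^ k / e" using e by (simp add: powr_diff powr_realpow)
      finally have "real N / (e ^ k / e) \<le> real N / y powr (real k - 1)"
        using y_ge_1 e by (intro divide_left_mono mult_pos_pos) auto
      also have "\<dots> = y\<^sup>2" using N_times_y powr_minus_divide[of y "real k - 1"] by simp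
      finally show ?thesis using e by (simp add: field_simps)
    qed
    \<comment> \<open>A weight of at least 1 is inserted to match
      \<open>sum_tuples_weighted_le\<close>.\<close>
    also have "y\<^sup>2 / e + 1 \<le> (2 ^ l) ^ card (\<Union>i<l. \<alpha> i) * (y\<^sup>2 / e + 1)"
    proof -
      have "(1::real) \<le> (2 ^ l) ^ card (\<Union>i<l. \<alpha> i)" by (intro one_le_power) auto
      from mult_right_mono[OF this, of "y\<^sup>2 / e + 1"] show ?thesis using e by simp
    qed
    finally show "real (card {n\<in>{1..N}. n \<in> sols l \<alpha> h}) \<le> (if rprod (\<Union>i<l. \<alpha> i) \<le> y\<^sup>2 then (2 ^ l) ^ card (\<Union>i<l. \<alpha> i) * (y\<^sup>2 / rprod (\<Union>i<l. \<alpha> i) + 1) else 0)"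
      using \<alpha>(3) by (simp add: e_def)
  qed
  also have "\<dots> \<le> (\<Sum>\<alpha>\<in>tuples. (if rprod (\<Union>i<l. \<alpha> i) \<le> y\<^sup>2 then (2 ^ l) ^ card (\<Union>i<l. \<alpha> i) * (y\<^sup>2 / rprod (\<Union>i<l. \<alpha> i) + 1) else 0))"
    using finite_tuples by (intro sum_mono2) (auto simp: \<T>_def rprod_nonneg)
  also have "\<dots> \<le> C * Z * y\<^sup>2 powr (2 * \<delta>) * (y\<^sup>2 + 1 * y\<^sup>2)"
    using y_ge_1 by (intro sum_tuples_weighted_le) auto
  also have "y\<^sup>2 powr (2 * \<delta>) = y powr (4 * \<delta>)"
    using y_ge_1 by (simp add: powr_powr flip: powr_numeral)
  finally have 2: "real (card E2) \<le> 2 * C * Z * y powr (4 * \<delta>) * y\<^sup>2" by (simp add: mult_ac)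
  show ?thesis using tot 1 2 by (simp add: algebra_simps)
qed

text \<open>Each \<open>\<alpha> i\<close> is a subset of \<open>D i\<close>, and the k-th power of
  the product of \<open>D i\<close> divides \<open>n + h i\<close>, which is at most
  \<open>2 * N\<close>. The number of such subsets is therefore governed by the divisor
  bound.\<close>

lemma card_divisor_tuples_le:
  assumes h: "\<And>i. i < l \<Longrightarrow> h i \<le> N" and n: "n \<in> {1..N}"
  shows "real (card {\<alpha>\<in>tuples. n \<in> sols l \<alpha> h}) \<le> (C * (2 * real N) powr \<delta>) ^ l"
proof -
  define D where "D = (\<lambda>i. {p\<in>P. p ^ k dvd n + h i})"
  have D: "D i \<subseteq> P" for i by (auto simp: D_def)
  have "{\<alpha>\<in>tuples. n \<in> sols l \<alpha> h} \<subseteq> PiE {..<l} (\<lambda>i. Pow (D i))"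
    by (auto simp: sols_def D_def intro!: PiE_I intro: PiE_arb dest: PiE_mem)
  then have "card {\<alpha>\<in>tuples. n \<in> sols l \<alpha> h} \<le> card (PiE {..<l} (\<lambda>i. Pow (D i)))"
    using finite_subset_P[OF D] by (intro card_mono finite_PiE) auto
  then have "real (card {\<alpha>\<in>tuples. n \<in> sols l \<alpha> h}) \<le> real (card (PiE {..<l} (\<lambda>i. Pow (D i))))" by (rule of_nat_mono)
  also have "\<dots> = (\<Prod>i<l. 2 ^ card (D i))" using finite_subset_P[OF D] by (simp add: card_PiE card_Pow)
  also have "\<dots> \<le> (\<Prod>i<l. C * (2 * real N) powr \<delta>)"
  proof (intro prod_mono conjI)
    fix i assume i: "i \<in> {..<l}"
    have "(2::real) ^ card (D i) \<le> (4 ^ l) ^ card (D i)"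
    proof (intro power_mono)
      have "(4::real) ^ 1 \<le> 4 ^ l" using l_pos by (intro power_increasing) auto
      then show "(2::real) \<le> 4 ^ l" by simp
    qed auto
    also have "\<dots> \<le> C * rprod (D i) powr \<delta>" by (rule C[OF D])
    also have "\<dots> \<le> C * (2 * real N) powr \<delta>"
    proof -
      have "(\<Prod>(D i)) ^ k dvd n + h i" using D by (subst power_dvd_P) (auto simp: D_def)
      moreover have "n + h i > 0" using n by auto
      ultimately have "(\<Prod>(D i)) ^ k \<le> n + h i" by (rule dvd_imp_le)
      moreover have "\<Prod>(D i) \<le> (\<Prod>(D i)) ^ k" using prod_pos_P[OF D, of i] k_pos by (intro self_le_power) auto
      moreover have "n + h i \<le> 2 * N" using n h[of i] i by auto
      ultimately have "\<Prod>(D i) \<le> 2 * N" by linarith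
      then have "real (\<Prod>(D i)) \<le> real (2 * N)" by (rule of_nat_mono)
      then have "rprod (D i) \<le> 2 * real N" by (simp add: rprod_def)
      then show ?thesis using C1 \<delta> by (intro mult_left_mono powr_mono2 rprod_nonneg) auto
    qed
    finally show "2 ^ card (D i) \<le> C * (2 * real N) powr \<delta>" .
  qed auto
  finally show ?thesis by simp
qed

section \<open>Absolute bounds for tuples whose union has a large product\<close>

definition cnt_sum :: "(nat \<Rightarrow> nat set) \<Rightarrow> real" where
  "cnt_sum \<alpha> = (\<Sum>n\<in>{1..N}. \<Prod>i<l. cnt k H (\<alpha> i) n)"

lemma cnt_sum_nonneg: "cnt_sum \<alpha> \<ge> 0"
  by (simp add: cnt_sum_def sum_nonneg prod_nonneg cnt_nonneg)

text \<open>After interchanging the sums, only exceptional \<open>n\<close> contribute for fixed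
  shifts, each through at most \<open>c\<close> tuples. The hypothesis \<open>H \<le> N\<close>
  keeps the shifts at most \<open>N\<close>, as both counting lemmas require.\<close>

lemma sum_cnt_big:
  assumes "H \<le> N"
  shows "(\<Sum>\<alpha>\<in>{\<alpha>\<in>tuples. rprod (\<Union>i<l. \<alpha> i) > y}. cnt_sum \<alpha>)
     \<le> real H ^ l * (((2 * real l + 2 * C) * Z * y powr (4 * \<delta>) * y\<^sup>2) * (C * (2 * real N) powr \<delta>) ^ l)"
proof -
  define B where "B = {\<alpha>\<in>tuples. rprod (\<Union>i<l. \<alpha> i) > y}"
  define \<H> where "\<H> = PiE {..<l} (\<lambda>_. {..<H})"
  define c where "c = (C * (2 * real N) powr \<delta>) ^ l"
  have finB: "finite B" using finite_tuples by (simp add: B_def)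
  have c0: "c \<ge> 0" using C1 by (simp add: c_def)
  have "(\<Sum>\<alpha>\<in>B. cnt_sum \<alpha>) = (\<Sum>\<alpha>\<in>B. \<Sum>h\<in>\<H>. real (card {n\<in>{1..N}. n \<in> sols l \<alpha> h}))"
    unfolding cnt_sum_def \<H>_def by (intro sum.cong refl sum_prod_cnt) (auto simp: B_def dest: PiE_mem)
  also have "\<dots> = (\<Sum>h\<in>\<H>. \<Sum>\<alpha>\<in>B. real (card {n\<in>{1..N}. n \<in> sols l \<alpha> h}))" by (rule sum.swap)
  also have "\<dots> \<le> (\<Sum>h\<in>\<H>. ((2 * real l + 2 * C) * Z * y powr (4 * \<delta>) * y\<^sup>2) * c)"
  proof (rule sum_mono)
    fix h assume "h \<in> \<H>"
    then have h: "h i \<le> N" if "i < l" for i using that assms by (force simp: \<H>_def PiE_iff)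
    have "(\<Sum>\<alpha>\<in>B. real (card {n\<in>{1..N}. n \<in> sols l \<alpha> h})) = (\<Sum>\<alpha>\<in>B. \<Sum>n\<in>{1..N}. of_bool (n \<in> sols l \<alpha> h))"
      by (simp only: card_filter_eq_sum finite_atLeastAtMost)
    also have "\<dots> = (\<Sum>n\<in>{1..N}. \<Sum>\<alpha>\<in>B. of_bool (n \<in> sols l \<alpha> h))" by (rule sum.swap)
    also have "\<dots> = (\<Sum>n\<in>{1..N}. real (card {\<alpha>\<in>B. n \<in> sols l \<alpha> h}))"
      by (simp only: card_filter_eq_sum finB)
    also have "\<dots> \<le> (\<Sum>n\<in>{1..N}. if n \<in> exceptional h then c else 0)"
    proof (rule sum_mono)
      fix n assume n: "n \<in> {1..N}"
      show "real (card {\<alpha>\<in>B. n \<in> sols l \<alpha> h}) \<le> (if n \<in> exceptional h then c else 0)"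
      proof (cases "n \<in> exceptional h")
        case True
        have "card {\<alpha>\<in>B. n \<in> sols l \<alpha> h} \<le> card {\<alpha>\<in>tuples. n \<in> sols l \<alpha> h}"
          using finite_tuples by (intro card_mono) (auto simp: B_def)
        then have "real (card {\<alpha>\<in>B. n \<in> sols l \<alpha> h}) \<le> real (card {\<alpha>\<in>tuples. n \<in> sols l \<alpha> h})" by (rule of_nat_mono)
        then show ?thesis using True card_divisor_tuples_le[of h n] h n by (simp add: c_def)
      next
        case False
        then have "{\<alpha>\<in>B. n \<in> sols l \<alpha> h} = {}" using n by (auto simp: B_def exceptional_def)
        then have "card {\<alpha>\<in>B. n \<in> sols l \<alpha> h} = 0" by (simp only: card.empty)
        then show ?thesis using False by (simp only: if_False of_nat_0 order_refl)
      qed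
    qed
    also have "\<dots> = (\<Sum>n\<in>exceptional h. c)"
      by (rule sum.mono_neutral_cong_right) (auto simp: exceptional_def)
    also have "\<dots> = real (card (exceptional h)) * c" by simp
    also have "\<dots> \<le> ((2 * real l + 2 * C) * Z * y powr (4 * \<delta>) * y\<^sup>2) * c"
      by (intro mult_right_mono card_exceptional_le h c0)
    finally show "(\<Sum>\<alpha>\<in>B. real (card {n\<in>{1..N}. n \<in> sols l \<alpha> h})) \<le> ((2 * real l + 2 * C) * Z * y powr (4 * \<delta>) * y\<^sup>2) * c" .
  qed
  also have "\<dots> = real H ^ l * (((2 * real l + 2 * C) * Z * y powr (4 * \<delta>) * y\<^sup>2) * c)"
    unfolding sum_constant \<H>_def card_shifts ..
  finally show ?thesis unfolding B_def c_def .
qed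

text \<open>The count \<open>N / e ^ k + 1\<close> is enough here: as \<open>e \<le> y\<close> and
  \<open>y \<le> N\<close>, the summand 1 costs no more than the main term.\<close>

lemma sum_cnt_small:
  "(\<Sum>\<alpha>\<in>{\<alpha>\<in>tuples. rprod (\<Union>i<l. \<alpha> i) \<le> y}. cnt_sum \<alpha>) \<le> C * Z * y powr (2 * \<delta>) * (2 * real H ^ l * real N)"
proof -
  have "(\<Sum>\<alpha>\<in>{\<alpha>\<in>tuples. rprod (\<Union>i<l. \<alpha> i) \<le> y}. cnt_sum \<alpha>) = (\<Sum>\<alpha>\<in>tuples. if rprod (\<Union>i<l. \<alpha> i) \<le> y then cnt_sum \<alpha> else 0)"
    using finite_tuples by (intro sum.mono_neutral_cong_left) auto
  also have "\<dots> \<le> (\<Sum>\<alpha>\<in>tuples. if rprod (\<Union>i<l. \<alpha> i) \<le> y then (2 ^ l) ^ card (\<Union>i<l. \<alpha> i) * (real H ^ l * real N / rprod (\<Union>i<l. \<alpha> i) + real H ^ l) else 0)"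
  proof (rule sum_mono)
    fix \<alpha> assume \<alpha>: "\<alpha> \<in> tuples"
    define e where "e = rprod (\<Union>i<l. \<alpha> i)"
    have e: "e \<ge> 1" unfolding e_def by (intro prod_ge_1_P tuples_Union \<alpha>)
    have "cnt_sum \<alpha> \<le> real H ^ l * (real N / e ^ k + 1)"
      unfolding cnt_sum_def e_def using tuplesD[OF \<alpha>] by (intro sum_prod_cnt_le)
    also have "\<dots> \<le> real H ^ l * (real N / e + 1)"
      using e k_pos self_le_power[of e k] by (intro mult_left_mono add_right_mono divide_left_mono) auto
    also have "\<dots> = 1 * (real H ^ l * real N / e + real H ^ l)" by (simp add: algebra_simps)
    also have "\<dots> \<le> (2 ^ l) ^ card (\<Union>i<l. \<alpha> i) * (real H ^ l * real N / e + real H ^ l)"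
      using e by (intro mult_right_mono one_le_power) auto
    finally show "(if rprod (\<Union>i<l. \<alpha> i) \<le> y then cnt_sum \<alpha> else 0) \<le> (if rprod (\<Union>i<l. \<alpha> i) \<le> y then (2 ^ l) ^ card (\<Union>i<l. \<alpha> i) * (real H ^ l * real N / rprod (\<Union>i<l. \<alpha> i) + real H ^ l) else 0)"
      by (simp add: e_def)
  qed
  also have "\<dots> \<le> C * Z * y powr (2 * \<delta>) * (real H ^ l * real N + real H ^ l * y)"
    using y_ge_1 by (intro sum_tuples_weighted_le) auto
  also have "\<dots> \<le> C * Z * y powr (2 * \<delta>) * (2 * real H ^ l * real N)"
  proof -
    have "real H ^ l * y \<le> real H ^ l * real N" using y_le_N by (intro mult_left_mono) auto
    then show ?thesis using C1 Z1 by (intro mult_left_mono) (auto simp: mult_ac)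
  qed
  finally show ?thesis .
qed

lemma gdev_tuple_le:
  assumes s: "s \<in> tuples"
  shows "\<bar>\<Sum>n\<in>{1..N}. \<Prod>i<l. gdev k H (s i) n\<bar> \<le> (\<Sum>\<alpha>\<in>PiE {..<l} (\<lambda>i. Pow (s i)). wt (\<lambda>i. s i - \<alpha> i) * cnt_sum \<alpha>)"
proof -
  have fin: "finite (s i)" if "i < l" for i using tuplesD[OF s that] finite_subset_P by blast
  have "\<bar>\<Sum>n\<in>{1..N}. \<Prod>i<l. gdev k H (s i) n\<bar> \<le> (\<Sum>n\<in>{1..N}. \<Prod>i<l. \<bar>gdev k H (s i) n\<bar>)"
    by (rule order_trans[OF sum_abs]) (simp add: abs_prod)
  also have "\<dots> \<le> (\<Sum>n\<in>{1..N}. \<Prod>i<l. \<Sum>A\<in>Pow (s i). cnt k H A n / rprod (s i - A) ^ k)"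
    using tuplesD[OF s] by (intro sum_mono prod_mono conjI gdev_le_cnt) auto
  also have "\<dots> = (\<Sum>n\<in>{1..N}. \<Sum>\<alpha>\<in>PiE {..<l} (\<lambda>i. Pow (s i)). \<Prod>i<l. cnt k H (\<alpha> i) n / rprod (s i - \<alpha> i) ^ k)"
    using fin by (intro sum.cong refl prod_sum_PiE) auto
  also have "\<dots> = (\<Sum>\<alpha>\<in>PiE {..<l} (\<lambda>i. Pow (s i)). \<Sum>n\<in>{1..N}. \<Prod>i<l. cnt k H (\<alpha> i) n / rprod (s i - \<alpha> i) ^ k)"
    by (rule sum.swap)
  also have "\<dots> = (\<Sum>\<alpha>\<in>PiE {..<l} (\<lambda>i. Pow (s i)). wt (\<lambda>i. s i - \<alpha> i) * cnt_sum \<alpha>)"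
    unfolding cnt_sum_def wt_def sum_distrib_left by (intro sum.cong refl) (simp flip: prod.distrib)
  finally show ?thesis .
qed

text \<open>A tuple \<open>s\<close> with subsets \<open>\<alpha> i \<subseteq> s i\<close> is
  recorded as the pair of \<open>\<alpha>\<close> and \<open>\<beta> i = s i - \<alpha> i\<close>.
  As the product over the union of \<open>s\<close> exceeds y^2, either the conditions
  \<open>\<alpha>\<close> or the mean parts \<open>\<beta>\<close> have product above
  \<open>y\<close>.\<close>

lemma sum_large_tuples:
  "(\<Sum>s\<in>{s\<in>tuples. rprod (\<Union>i<l. s i) > y\<^sup>2}. \<bar>\<Sum>n\<in>{1..N}. \<Prod>i<l. gdev k H (s i) n\<bar>)
   \<le> (\<Sum>\<alpha>\<in>{\<alpha>\<in>tuples. rprod (\<Union>i<l. \<alpha> i) > y}. cnt_sum \<alpha>) * (\<Sum>\<beta>\<in>tuples. wt \<beta>)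
    + (\<Sum>\<alpha>\<in>{\<alpha>\<in>tuples. rprod (\<Union>i<l. \<alpha> i) \<le> y}. cnt_sum \<alpha>) * (\<Sum>\<beta>\<in>{\<beta>\<in>tuples. (\<Prod>i<l. rprod (\<beta> i)) > y}. wt \<beta>)"
proof -
  define L where "L = {s\<in>tuples. rprod (\<Union>i<l. s i) > y\<^sup>2}"
  define A1 where "A1 = {\<alpha>\<in>tuples. rprod (\<Union>i<l. \<alpha> i) > y}"
  define A2 where "A2 = {\<alpha>\<in>tuples. rprod (\<Union>i<l. \<alpha> i) \<le> y}"
  define B2 where "B2 = {\<beta>\<in>tuples. (\<Prod>i<l. rprod (\<beta> i)) > y}"
  define X where "X = (SIGMA s:L. PiE {..<l} (\<lambda>i. Pow (s i)))"
  define Y where "Y = A1 \<times> tuples \<union> A2 \<times> B2"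
  have fin: "finite L" "finite A1" "finite A2" "finite B2" "finite Y" using finite_tuples
    by (auto simp: L_def A1_def A2_def B2_def Y_def)
  have finP: "finite (PiE {..<l} (\<lambda>i. Pow (s i)))" if "s \<in> L" for s
    using that tuplesD[of s] finite_subset_P by (intro finite_PiE) (auto simp: L_def)
  \<comment> \<open>Recovers \<open>s\<close> and \<open>\<alpha>\<close> from the recorded pair, so
    distinct terms on the left use distinct pairs on the right.\<close>
  define split where "split = (\<lambda>(\<alpha>::nat\<Rightarrow>nat set, \<beta>). (\<lambda>i\<in>{..<l}. \<alpha> i \<union> \<beta> i, \<alpha>))"
  have "(\<Sum>s\<in>L. \<bar>\<Sum>n\<in>{1..N}. \<Prod>i<l. gdev k H (s i) n\<bar>) \<le> (\<Sum>s\<in>L. \<Sum>\<alpha>\<in>PiE {..<l} (\<lambda>i. Pow (s i)). wt (\<lambda>i. s i - \<alpha> i) * cnt_sum \<alpha>)"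
    by (intro sum_mono gdev_tuple_le) (auto simp: L_def)
  also have "\<dots> = (\<Sum>(s,\<alpha>)\<in>X. wt (\<lambda>i. s i - \<alpha> i) * cnt_sum \<alpha>)"
    unfolding X_def using fin finP by (intro sum.Sigma) auto
  also have "\<dots> \<le> (\<Sum>(\<alpha>,\<beta>)\<in>Y. wt \<beta> * cnt_sum \<alpha>)"
  proof (rule sum_le_included[where i = split])
    show "finite X" unfolding X_def using fin finP by auto
    show "finite Y" by (rule fin)
    show "\<forall>y\<in>Y. 0 \<le> (case y of (\<alpha>, \<beta>) \<Rightarrow> wt \<beta> * cnt_sum \<alpha>)"
      by (auto intro!: mult_nonneg_nonneg wt_nonneg cnt_sum_nonneg)
    show "\<forall>x\<in>X. \<exists>z\<in>Y. split z = x \<and> (case x of (s, \<alpha>) \<Rightarrow> wt (\<lambda>i. s i - \<alpha> i) * cnt_sum \<alpha>) \<le> (case z of (\<alpha>, \<beta>) \<Rightarrow> wt \<beta> * cnt_sum \<alpha>)"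
    proof (intro ballI)
      fix x assume "x \<in> X"
      then obtain s \<alpha> where x: "x = (s, \<alpha>)" "s \<in> L" "\<alpha> \<in> PiE {..<l} (\<lambda>i. Pow (s i))" by (auto simp: X_def)
      define \<beta> where "\<beta> = (\<lambda>i\<in>{..<l}. s i - \<alpha> i)"
      have s: "s \<in> tuples" "rprod (\<Union>i<l. s i) > y\<^sup>2" using x by (auto simp: L_def)
      have \<alpha>s: "\<alpha> i \<subseteq> s i" if "i < l" for i using x(3) that by (auto dest: PiE_mem)
      have \<alpha>: "\<alpha> \<in> tuples" using x(3) s(1) by (auto intro!: PiE_I intro: PiE_arb dest: PiE_mem)
      have \<beta>: "\<beta> \<in> tuples" using s(1) by (auto simp: \<beta>_def dest: PiE_mem)
      have eq: "(\<Union>i<l. s i) = (\<Union>i<l. \<alpha> i) \<union> (\<Union>i<l. \<beta> i)" using \<alpha>s by (auto simp: \<beta>_def)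
      have "y\<^sup>2 < rprod (\<Union>i<l. \<alpha> i) * rprod (\<Union>i<l. \<beta> i)"
        using s(2) unfolding eq by (rule less_le_trans) (intro rprod_Un_le tuples_Union \<alpha> \<beta>)
      also have "\<dots> \<le> rprod (\<Union>i<l. \<alpha> i) * (\<Prod>i<l. rprod (\<beta> i))"
        using tuplesD[OF \<beta>] by (intro mult_left_mono rprod_UN_le rprod_nonneg)
      finally have *: "y\<^sup>2 < rprod (\<Union>i<l. \<alpha> i) * (\<Prod>i<l. rprod (\<beta> i))" .
      have "(\<alpha>, \<beta>) \<in> Y"
      proof (cases "rprod (\<Union>i<l. \<alpha> i) > y")
        case True
        then show ?thesis using \<alpha> \<beta> by (auto simp: Y_def A1_def)
      next
        case False
        have "(\<Prod>i<l. rprod (\<beta> i)) > y"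
        proof (rule ccontr)
          assume "\<not> ?thesis"
          then have "rprod (\<Union>i<l. \<alpha> i) * (\<Prod>i<l. rprod (\<beta> i)) \<le> y * y"
            using False y_ge_1 by (intro mult_mono prod_nonneg rprod_nonneg) auto
          then show False using * by (simp add: power2_eq_square)
        qed
        then show ?thesis using False \<alpha> \<beta> by (auto simp: Y_def A2_def B2_def)
      qed
      moreover have "split (\<alpha>, \<beta>) = x"
      proof -
        have "(\<lambda>i\<in>{..<l}. \<alpha> i \<union> \<beta> i) = s"
        proof
          fix i show "(\<lambda>i\<in>{..<l}. \<alpha> i \<union> \<beta> i) i = s i"
            using \<alpha>s[of i] PiE_arb[OF s(1), of i] by (auto simp: \<beta>_def)
        qed
        then show ?thesis by (simp add: split_def x)
      qed
      moreover have "wt (\<lambda>i. s i - \<alpha> i) = wt \<beta>" unfolding wt_def \<beta>_def by (intro prod.cong) auto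
      ultimately show "\<exists>z\<in>Y. split z = x \<and> (case x of (s, \<alpha>) \<Rightarrow> wt (\<lambda>i. s i - \<alpha> i) * cnt_sum \<alpha>) \<le> (case z of (\<alpha>, \<beta>) \<Rightarrow> wt \<beta> * cnt_sum \<alpha>)"
        by (intro bexI[of _ "(\<alpha>, \<beta>)"]) (simp_all add: x)
    qed
  qed
  also have "\<dots> = (\<Sum>(\<alpha>,\<beta>)\<in>A1 \<times> tuples. wt \<beta> * cnt_sum \<alpha>) + (\<Sum>(\<alpha>,\<beta>)\<in>A2 \<times> B2. wt \<beta> * cnt_sum \<alpha>)"
    unfolding Y_def using fin finite_tuples by (intro sum.union_disjoint) (auto simp: A1_def A2_def)
  also have "\<dots> = (\<Sum>\<alpha>\<in>A1. cnt_sum \<alpha>) * (\<Sum>\<beta>\<in>tuples. wt \<beta>) + (\<Sum>\<alpha>\<in>A2. cnt_sum \<alpha>) * (\<Sum>\<beta>\<in>B2. wt \<beta>)"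
    unfolding sum_product sum.cartesian_product[symmetric] by (simp only: mult.commute)
  finally show ?thesis unfolding L_def A1_def A2_def B2_def .
qed

section \<open>Expansion and moments of the truncated deviation\<close>

definition coeff :: "nat set \<Rightarrow> real" where
  "coeff S = (-1) ^ card S * (\<Prod>p\<in>P - S. 1 - 1 / real p ^ k)"

lemma abs_coeff_le: "\<bar>coeff S\<bar> \<le> 1"
proof -
  have "(\<Prod>p\<in>P - S. \<bar>1 - 1 / real p ^ k\<bar>) \<le> (\<Prod>p\<in>P - S. 1)"
  proof (intro prod_mono conjI)
    fix p assume "p \<in> P - S"
    then have "real p ^ k \<ge> 1" using prime_P[of p] by (intro one_le_power) (auto dest: prime_ge_1_nat)
    then have "0 < real p ^ k" "1 \<le> real p ^ k" by linarith+
    then have "0 \<le> 1 / real p ^ k" "1 / real p ^ k \<le> 1" unfolding divide_le_eq_1 by simp_all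
    then show "\<bar>1 - 1 / real p ^ k\<bar> \<le> 1" by linarith
  qed auto
  then show ?thesis by (simp add: coeff_def abs_mult power_abs abs_prod)
qed

text \<open>Each sieve factor is \<open>(1 - 1 / real p ^ k) - dev k p (n + h)\<close>, and
  \<open>coeff S\<close> arises by multiplying out. The term of the empty set is exactly the main
  term subtracted in \<open>D_trunc\<close>.\<close>

lemma D_trunc_expand: "D_trunc P k H n = (\<Sum>S\<in>Pow P - {{}}. coeff S * gdev k H S n)"
proof -
  have "(\<Prod>p\<in>P. 1 - of_bool (p ^ k dvd n + h)) = (\<Sum>S\<in>Pow P. coeff S * (\<Prod>p\<in>S. dev k p (n + h)))" for h
  proof -
    have "(\<Prod>p\<in>P. 1 - of_bool (p ^ k dvd n + h)) = (\<Prod>p\<in>P. (1 - 1 / real p ^ k) - dev k p (n + h))"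
      by (simp add: dev_def)
    also have "\<dots> = (\<Sum>S\<in>Pow P. (-1) ^ card S * (\<Prod>p\<in>S. dev k p (n + h)) * (\<Prod>p\<in>P - S. 1 - 1 / real p ^ k))"
      by (rule prod_diff_conv_sum[OF finite_P])
    finally show ?thesis by (simp add: coeff_def mult_ac)
  qed
  then have "(\<Sum>h<H. \<Prod>p\<in>P. 1 - of_bool (p ^ k dvd n + h)) = (\<Sum>h<H. \<Sum>S\<in>Pow P. coeff S * (\<Prod>p\<in>S. dev k p (n + h)))"
    by simp
  also have "\<dots> = (\<Sum>S\<in>Pow P. coeff S * gdev k H S n)"
    unfolding gdev_def sum_distrib_left by (rule sum.swap)
  also have "\<dots> = coeff {} * gdev k H {} n + (\<Sum>S\<in>Pow P - {{}}. coeff S * gdev k H S n)"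
    using finite_P by (intro sum.remove) auto
  also have "coeff {} * gdev k H {} n = real H * (\<Prod>p\<in>P. 1 - 1 / real p ^ k)"
    by (simp add: coeff_def gdev_def)
  finally show ?thesis by (simp add: D_trunc_def)
qed

text \<open>The part with small product keeps its sets nonempty, as \<open>gdev_bound\<close>
  requires; the part with large product is treated by absolute values and may be enlarged to all
  tuples.\<close>

lemma sum_D_trunc_power_le:
  "\<bar>\<Sum>n\<in>{1..N}. D_trunc P k H n ^ l\<bar> \<le>
    (\<Sum>s\<in>{s\<in>PiE {..<l} (\<lambda>_. Pow P - {{}}). rprod (\<Union>i<l. s i) \<le> y\<^sup>2}. \<bar>\<Sum>n\<in>{1..N}. \<Prod>i<l. gdev k H (s i) n\<bar>)
  + (\<Sum>s\<in>{s\<in>tuples. rprod (\<Union>i<l. s i) > y\<^sup>2}. \<bar>\<Sum>n\<in>{1..N}. \<Prod>i<l. gdev k H (s i) n\<bar>)"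
proof -
  define T where "T = PiE {..<l} (\<lambda>_. Pow P - {{}})"
  define G where "G = (\<lambda>s. \<bar>\<Sum>n\<in>{1..N}. \<Prod>i<l. gdev k H (s i) n\<bar>)"
  have sub: "T \<subseteq> tuples" unfolding T_def by (intro PiE_mono) auto
  then have finT: "finite T" using finite_tuples finite_subset by blast
  have "D_trunc P k H n ^ l = (\<Sum>s\<in>T. (\<Prod>i<l. coeff (s i)) * (\<Prod>i<l. gdev k H (s i) n))" for n
  proof -
    have "D_trunc P k H n ^ l = (\<Prod>i<l. \<Sum>S\<in>Pow P - {{}}. coeff S * gdev k H S n)"
      by (simp add: D_trunc_expand)
    also have "\<dots> = (\<Sum>s\<in>T. \<Prod>i<l. coeff (s i) * gdev k H (s i) n)"
      unfolding T_def using finite_P by (intro prod_sum_PiE) auto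
    finally show ?thesis by (simp add: prod.distrib)
  qed
  then have "(\<Sum>n\<in>{1..N}. D_trunc P k H n ^ l) = (\<Sum>n\<in>{1..N}. \<Sum>s\<in>T. (\<Prod>i<l. coeff (s i)) * (\<Prod>i<l. gdev k H (s i) n))" by simp
  also have "\<dots> = (\<Sum>s\<in>T. (\<Prod>i<l. coeff (s i)) * (\<Sum>n\<in>{1..N}. \<Prod>i<l. gdev k H (s i) n))"
    unfolding sum_distrib_left by (rule sum.swap)
  also have "\<bar>\<dots>\<bar> \<le> (\<Sum>s\<in>T. G s)"
  proof (rule order_trans[OF sum_abs], rule sum_mono)
    fix s
    have "\<bar>\<Prod>i<l. coeff (s i)\<bar> \<le> (\<Prod>i<l. 1)"
      unfolding abs_prod by (intro prod_mono conjI abs_coeff_le) auto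
    then have "\<bar>\<Prod>i<l. coeff (s i)\<bar> * G s \<le> 1 * G s" by (intro mult_right_mono) (auto simp: G_def)
    then show "\<bar>(\<Prod>i<l. coeff (s i)) * (\<Sum>n\<in>{1..N}. \<Prod>i<l. gdev k H (s i) n)\<bar> \<le> G s"
      by (simp add: G_def abs_mult)
  qed
  also have "\<dots> = (\<Sum>s\<in>{s\<in>T. rprod (\<Union>i<l. s i) \<le> y\<^sup>2}. G s) + (\<Sum>s\<in>{s\<in>T. rprod (\<Union>i<l. s i) > y\<^sup>2}. G s)"
    using finT by (subst sum.union_disjoint[symmetric]) (auto intro!: sum.cong)
  also have "(\<Sum>s\<in>{s\<in>T. rprod (\<Union>i<l. s i) > y\<^sup>2}. G s) \<le> (\<Sum>s\<in>{s\<in>tuples. rprod (\<Union>i<l. s i) > y\<^sup>2}. G s)"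
    using sub finite_tuples by (intro sum_mono2) (auto simp: G_def)
  finally show ?thesis by (simp add: T_def G_def)
qed

lemma sum_small_tuples:
  "(\<Sum>s\<in>{s\<in>PiE {..<l} (\<lambda>_. Pow P - {{}}). rprod (\<Union>i<l. s i) \<le> y\<^sup>2}. \<bar>\<Sum>n\<in>{1..N}. \<Prod>i<l. gdev k H (s i) n\<bar>)
   \<le> C * Z * y\<^sup>2 powr (2 * \<delta>) * (2 ^ l * real H powr (real l / (2 * real k)) * real N + real H ^ l * y\<^sup>2)"
proof -
  define T where "T = {s\<in>PiE {..<l} (\<lambda>_. Pow P - {{}}). rprod (\<Union>i<l. s i) \<le> y\<^sup>2}"
  let ?a = "2 ^ l * real H powr (real l / (2 * real k)) * real N"
  let ?F = "\<lambda>s. if rprod (\<Union>i<l. s i) \<le> y\<^sup>2 then (2 ^ l) ^ card (\<Union>i<l. s i) * (?a / rprod (\<Union>i<l. s i) + real H ^ l) else 0"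
  have "PiE {..<l} (\<lambda>_. Pow P - {{}}) \<subseteq> tuples" by (intro PiE_mono) auto
  then have sub: "T \<subseteq> tuples" by (auto simp: T_def)
  have "(\<Sum>s\<in>T. \<bar>\<Sum>n\<in>{1..N}. \<Prod>i<l. gdev k H (s i) n\<bar>) \<le> (\<Sum>s\<in>T. ?F s)"
  proof (rule sum_mono)
    fix s assume s: "s \<in> T"
    then have "s i \<subseteq> P \<and> s i \<noteq> {}" if "i < l" for i using that by (auto simp: T_def dest: PiE_mem)
    then have "\<bar>\<Sum>n\<in>{1..N}. \<Prod>i<l. gdev k H (s i) n\<bar> \<le> (2 ^ l) ^ card (\<Union>i<l. s i) * (?a / rprod (\<Union>i<l. s i) + real H ^ l)"
      by (rule small_tuple_bound)
    then show "\<bar>\<Sum>n\<in>{1..N}. \<Prod>i<l. gdev k H (s i) n\<bar> \<le> ?F s" using s by (simp add: T_def)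
  qed
  also have "\<dots> \<le> (\<Sum>s\<in>tuples. ?F s)"
    using sub finite_tuples by (intro sum_mono2) (auto simp: rprod_nonneg)
  also have "\<dots> \<le> C * Z * y\<^sup>2 powr (2 * \<delta>) * (?a + real H ^ l * y\<^sup>2)"
    using y_ge_1 by (intro sum_tuples_weighted_le) auto
  finally show ?thesis unfolding T_def .
qed

text \<open>The three parts of the constant belong to the tuples of small product, to those of large
  product with large conditions, and to those of large product whose conditions are small but whose
  mean parts are large.\<close>

lemma moment_trunc_bound:
  assumes HN: "H \<le> N"
  shows "\<bar>\<Sum>n\<in>{1..N}. D_trunc P k H n ^ l\<bar> \<le>
    (2 ^ l * C * Z + (2 * real l + 2 * C) * Z * Z ^ l * (2 * C) ^ l + 2 * C * Z * Z ^ l)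
    * (real N powr ((real l + 4) * \<delta>) * (real H powr (real l / (2 * real k)) * real N + real H ^ l * y\<^sup>2))"
proof -
  define a where "a = real H powr (real l / (2 * real k)) * real N"
  define b where "b = real H ^ l * y\<^sup>2"
  define V where "V = real N powr ((real l + 4) * \<delta>)"
  have ab: "a \<ge> 0" "b \<ge> 0" by (auto simp: a_def b_def)
  have N1: "real N \<ge> 1" using N_pos by simp
  \<comment> \<open>All powers whose exponent is a multiple of \<delta> are collected in
    \<open>V\<close>; the worst case is 4 \<delta> on \<open>y\<close> together with l \<delta> on
    \<open>N\<close> from the divisor bound.\<close>
  have ypow: "y powr (j * \<delta>) * real N powr (i * \<delta>) \<le> V" if "0 \<le> j" "0 \<le> i" "i + j \<le> real l + 4" for i j
  proof -
    have "y powr (j * \<delta>) \<le> real N powr (j * \<delta>)" using y_ge_1 y_le_N that \<delta> by (intro powr_mono2) auto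
    then have "y powr (j * \<delta>) * real N powr (i * \<delta>) \<le> real N powr (j * \<delta>) * real N powr (i * \<delta>)"
      by (intro mult_right_mono) auto
    also have "\<dots> = real N powr ((i + j) * \<delta>)" by (simp add: algebra_simps flip: powr_add)
    also have "\<dots> \<le> V" unfolding V_def using N1 that \<delta> by (intro powr_mono mult_right_mono) auto
    finally show ?thesis .
  qed
  have yV: "y powr (j * \<delta>) \<le> V" if "0 \<le> j" "j \<le> real l + 4" for j
    using ypow[of j 0] that N1 by simp
  have "(\<Sum>s\<in>{s\<in>PiE {..<l} (\<lambda>_. Pow P - {{}}). rprod (\<Union>i<l. s i) \<le> y\<^sup>2}. \<bar>\<Sum>n\<in>{1..N}. \<Prod>i<l. gdev k H (s i) n\<bar>)
    \<le> C * Z * y\<^sup>2 powr (2 * \<delta>) * (2 ^ l * a + b)"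
    using sum_small_tuples by (simp add: a_def b_def mult_ac)
  also have "\<dots> \<le> C * Z * V * (2 ^ l * (a + b))"
  proof (intro mult_mono mult_left_mono)
    have "y\<^sup>2 powr (2 * \<delta>) = y powr (4 * \<delta>)" using y_ge_1 by (simp add: powr_powr flip: powr_numeral)
    then show "y\<^sup>2 powr (2 * \<delta>) \<le> V" using yV[of 4] by simp
    have "1 * b \<le> 2 ^ l * b" using ab by (intro mult_right_mono) auto
    then show "2 ^ l * a + b \<le> 2 ^ l * (a + b)" by (simp add: distrib_left)
  qed (use C1 Z1 ab in \<open>auto simp: V_def\<close>)
  finally have small: "(\<Sum>s\<in>{s\<in>PiE {..<l} (\<lambda>_. Pow P - {{}}). rprod (\<Union>i<l. s i) \<le> y\<^sup>2}. \<bar>\<Sum>n\<in>{1..N}. \<Prod>i<l. gdev k H (s i) n\<bar>)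
    \<le> 2 ^ l * C * Z * (V * (a + b))" by (simp add: mult_ac)
  have "(\<Sum>\<alpha>\<in>{\<alpha>\<in>tuples. rprod (\<Union>i<l. \<alpha> i) > y}. cnt_sum \<alpha>) * (\<Sum>\<beta>\<in>tuples. wt \<beta>)
    \<le> (real H ^ l * (((2 * real l + 2 * C) * Z * y powr (4 * \<delta>) * y\<^sup>2) * (C * (2 * real N) powr \<delta>) ^ l)) * Z ^ l"
    using C1 Z1 by (intro mult_mono sum_cnt_big HN sum_wt sum_nonneg wt_nonneg) auto
  also have "\<dots> = (2 * real l + 2 * C) * Z * Z ^ l * C ^ l * b * (y powr (4 * \<delta>) * ((2 * real N) powr \<delta>) ^ l)"
    by (simp add: b_def power_mult_distrib mult_ac)
  also have "\<dots> \<le> (2 * real l + 2 * C) * Z * Z ^ l * C ^ l * b * (2 ^ l * V)"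
  proof (intro mult_left_mono)
    have "((2 * real N) powr \<delta>) ^ l = (2 powr \<delta>) ^ l * real N powr (real l * \<delta>)"
      using N1 by (simp add: powr_mult power_mult_distrib powr_power)
    also have "\<dots> \<le> 2 ^ l * real N powr (real l * \<delta>)"
      using powr_mono[of \<delta> 1 "2::real"] \<delta> by (intro mult_right_mono power_mono) auto
    finally have "y powr (4 * \<delta>) * ((2 * real N) powr \<delta>) ^ l \<le> y powr (4 * \<delta>) * (2 ^ l * real N powr (real l * \<delta>))"
      by (intro mult_left_mono) auto
    also have "\<dots> = 2 ^ l * (y powr (4 * \<delta>) * real N powr (real l * \<delta>))" by simp
    also have "\<dots> \<le> 2 ^ l * V" by (intro mult_left_mono ypow) auto
    finally show "y powr (4 * \<delta>) * ((2 * real N) powr \<delta>) ^ l \<le> 2 ^ l * V" .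
  qed (use C1 Z1 ab in auto)
  also have "\<dots> = (2 * real l + 2 * C) * Z * Z ^ l * (2 * C) ^ l * (V * b)" by (simp add: power_mult_distrib)
  also have "\<dots> \<le> (2 * real l + 2 * C) * Z * Z ^ l * (2 * C) ^ l * (V * (a + b))"
    using C1 Z1 ab by (intro mult_left_mono) (auto simp: V_def)
  finally have big: "(\<Sum>\<alpha>\<in>{\<alpha>\<in>tuples. rprod (\<Union>i<l. \<alpha> i) > y}. cnt_sum \<alpha>) * (\<Sum>\<beta>\<in>tuples. wt \<beta>) \<le> (2 * real l + 2 * C) * Z * Z ^ l * (2 * C) ^ l * (V * (a + b))" .
  have "(\<Sum>\<alpha>\<in>{\<alpha>\<in>tuples. rprod (\<Union>i<l. \<alpha> i) \<le> y}. cnt_sum \<alpha>) * (\<Sum>\<beta>\<in>{\<beta>\<in>tuples. (\<Prod>i<l. rprod (\<beta> i)) > y}. wt \<beta>)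
    \<le> (C * Z * y powr (2 * \<delta>) * (2 * real H ^ l * real N)) * (Z ^ l * y powr (\<delta> + (1 - real k)))"
    using C1 Z1 by (intro mult_mono sum_cnt_small sum_wt_tail sum_nonneg wt_nonneg) auto
  also have "\<dots> = 2 * C * Z * Z ^ l * (real H ^ l * (real N * y powr (1 - real k))) * (y powr (2 * \<delta>) * y powr \<delta>)"
    by (simp add: powr_add mult_ac)
  also have "\<dots> = 2 * C * Z * Z ^ l * b * y powr (3 * \<delta>)"
    unfolding N_times_y b_def powr_add[symmetric] by (simp add: algebra_simps)
  also have "\<dots> \<le> 2 * C * Z * Z ^ l * b * V"
    using C1 Z1 ab yV[of 3] by (intro mult_left_mono) auto
  also have "\<dots> \<le> 2 * C * Z * Z ^ l * (a + b) * V"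
    using C1 Z1 ab by (intro mult_left_mono mult_right_mono) (auto simp: V_def)
  finally have mixed: "(\<Sum>\<alpha>\<in>{\<alpha>\<in>tuples. rprod (\<Union>i<l. \<alpha> i) \<le> y}. cnt_sum \<alpha>) * (\<Sum>\<beta>\<in>{\<beta>\<in>tuples. (\<Prod>i<l. rprod (\<beta> i)) > y}. wt \<beta>)
    \<le> 2 * C * Z * Z ^ l * (V * (a + b))" by (simp add: mult_ac)
  have "\<bar>\<Sum>n\<in>{1..N}. D_trunc P k H n ^ l\<bar> \<le> 2 ^ l * C * Z * (V * (a + b)) + ((2 * real l + 2 * C) * Z * Z ^ l * (2 * C) ^ l * (V * (a + b)) + 2 * C * Z * Z ^ l * (V * (a + b)))"
    by (rule order_trans[OF sum_D_trunc_power_le add_mono[OF small order_trans[OF sum_large_tuples add_mono[OF big mixed]]]])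
  then show ?thesis unfolding a_def b_def V_def by (simp only: distrib_right add.assoc)
qed

text \<open>Plain inclusion and exclusion: for \<open>e\<^sup>2 \<le> 2 * real H\<close> each count
  has error at most 1. For larger \<open>e\<close>, \<open>n \<le> H\<close> puts every
  \<open>n + h\<close> below \<open>e ^ k\<close>, so the count is zero and only
  \<open>H / e ^ k\<close> remains. Both cases are bounded by a multiple of H^((1+\<delta>)/2)
  e^-(1+\<delta>), which is summable over the sets.\<close>

lemma D_trunc_le_sqrt:
  assumes n: "1 \<le> n" "n \<le> H"
  shows "\<bar>D_trunc P k H n\<bar> \<le> 2 * Z * real H powr ((1 + \<delta>) / 2)"
proof -
  have fin: "finite A" if "A \<subseteq> P" for A using that finite_subset_P by blast
  have "(\<Sum>h<H. \<Prod>p\<in>P. (1::real) - of_bool (p ^ k dvd n + h)) = (\<Sum>h<H. \<Sum>S\<in>Pow P. (-1) ^ card S * of_bool (\<forall>p\<in>S. p ^ k dvd n + h))"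
    by (intro sum.cong refl, subst prod_diff_conv_sum[OF finite_P]) (auto simp: prod_of_bool fin intro!: sum.cong)
  also have "\<dots> = (\<Sum>S\<in>Pow P. (-1) ^ card S * cnt k H S n)"
    unfolding cnt_def sum_distrib_left by (rule sum.swap)
  finally have 1: "(\<Sum>h<H. \<Prod>p\<in>P. (1::real) - of_bool (p ^ k dvd n + h)) = (\<Sum>S\<in>Pow P. (-1) ^ card S * cnt k H S n)" .
  have "(\<Prod>p\<in>P. 1 - 1 / real p ^ k) = (\<Sum>S\<in>Pow P. (-1) ^ card S * (1 / rprod S ^ k))"
    unfolding prod_diff_conv_sum[OF finite_P] prod_inverse_power by simp
  then have "D_trunc P k H n = (\<Sum>S\<in>Pow P. (-1) ^ card S * (cnt k H S n - real H / rprod S ^ k))"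
    unfolding D_trunc_def 1 by (simp add: sum_distrib_left right_diff_distrib sum_subtractf mult_ac)
  also have "\<bar>\<dots>\<bar> \<le> (\<Sum>S\<in>Pow P. 2 * real H powr ((1 + \<delta>) / 2) * rprod S powr - (1 + \<delta>))"
  proof (rule order_trans[OF sum_abs], rule sum_mono)
    fix S assume "S \<in> Pow P"
    then have S: "S \<subseteq> P" by auto
    define e where "e = rprod S"
    have e: "e \<ge> 1" using prod_ge_1_P[OF S] by (simp add: e_def)
    have H1: "real H \<ge> 1" using H_pos by simp
    have half: "sqrt (real H) powr (1 + \<delta>) = real H powr ((1 + \<delta>) / 2)"
      using H1 by (simp add: powr_half_sqrt[symmetric] powr_powr)
    have two: "sqrt 2 powr (1 + \<delta>) \<le> 2"
    proof -
      have "sqrt 2 powr (1 + \<delta>) \<le> sqrt 2 powr 2" using \<delta> by (intro powr_mono) auto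
      then show ?thesis by (simp add: powr_numeral)
    qed
    have "\<bar>cnt k H S n - real H / e ^ k\<bar> \<le> 2 * real H powr ((1 + \<delta>) / 2) * e powr - (1 + \<delta>)"
    proof (cases "e\<^sup>2 \<le> 2 * real H")
      case True
      then have "e \<le> sqrt 2 * sqrt (real H)" using e by (simp add: real_le_rsqrt flip: real_sqrt_mult)
      then have "e powr (1 + \<delta>) \<le> (sqrt 2 * sqrt (real H)) powr (1 + \<delta>)" using e \<delta> by (intro powr_mono2) auto
      also have "\<dots> = sqrt 2 powr (1 + \<delta>) * real H powr ((1 + \<delta>) / 2)" using half by (simp add: powr_mult)
      also have "\<dots> \<le> 2 * real H powr ((1 + \<delta>) / 2)" using two by (intro mult_right_mono) auto
      finally have "e powr (1 + \<delta>) * e powr - (1 + \<delta>) \<le> 2 * real H powr ((1 + \<delta>) / 2) * e powr - (1 + \<delta>)"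
        by (rule mult_right_mono) auto
      moreover have "e powr (1 + \<delta>) * e powr - (1 + \<delta>) = 1"
        unfolding powr_add[symmetric] using e by simp
      ultimately have "1 \<le> 2 * real H powr ((1 + \<delta>) / 2) * e powr - (1 + \<delta>)" by (simp only:)
      then show ?thesis using cnt_approx[OF S, of n] by (simp add: e_def)
    next
      case False
      have big: "e ^ k \<ge> e\<^sup>2" using e k_ge_2 by (intro power_increasing) auto
      have "of_bool (\<forall>p\<in>S. p ^ k dvd n + h) = (0::real)" if "h < H" for h
      proof -
        have "\<not> (\<Prod>S) ^ k dvd n + h"
        proof
          assume "(\<Prod>S) ^ k dvd n + h"
          then have "(\<Prod>S) ^ k \<le> n + h" using n by (intro dvd_imp_le) auto
          then have "(\<Prod>S) ^ k \<le> 2 * H" using n that by linarith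
          then have "real ((\<Prod>S) ^ k) \<le> real (2 * H)" by (rule of_nat_mono)
          then have "e ^ k \<le> 2 * real H" by (simp add: e_def rprod_def)
          then show False using big False by linarith
        qed
        then show ?thesis using power_dvd_P[OF S] by simp
      qed
      then have "cnt k H S n = 0" unfolding cnt_def by (intro sum.neutral) blast
      then have "\<bar>cnt k H S n - real H / e ^ k\<bar> = real H / e ^ k" using e by simp
      also have "\<dots> \<le> real H / e\<^sup>2" using big e by (intro divide_left_mono) auto
      also have "\<dots> = (sqrt (real H) / e)\<^sup>2" by (simp add: power_divide)
      also have "\<dots> = (sqrt (real H) / e) powr 2" using e H1 by (simp add: powr_numeral)
      \<comment> \<open>The base is at most 1, so lowering the exponent increases the power.\<close>
      also have "\<dots> \<le> (sqrt (real H) / e) powr (1 + \<delta>)"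
      proof (rule powr_mono')
        have "real H \<le> e\<^sup>2" using False by simp
        then have "sqrt (real H) \<le> e" using e by (simp add: real_le_lsqrt)
        then show "sqrt (real H) / e \<le> 1" using e by simp
      qed (use \<delta> e in auto)
      also have "\<dots> = real H powr ((1 + \<delta>) / 2) / e powr (1 + \<delta>)"
        by (subst powr_divide) (use e half in simp_all)
      also have "\<dots> = real H powr ((1 + \<delta>) / 2) * e powr - (1 + \<delta>)"
        by (simp only: powr_minus_divide times_divide_eq_right mult_1_right)
      also have "\<dots> \<le> 2 * real H powr ((1 + \<delta>) / 2) * e powr - (1 + \<delta>)" by (intro mult_right_mono) auto
      finally show ?thesis .
    qed
    then show "\<bar>(-1) ^ card S * (cnt k H S n - real H / rprod S ^ k)\<bar> \<le> 2 * real H powr ((1 + \<delta>) / 2) * rprod S powr - (1 + \<delta>)"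
      by (simp add: abs_mult power_abs e_def)
  qed
  also have "\<dots> = 2 * real H powr ((1 + \<delta>) / 2) * (\<Sum>S\<in>Pow P. rprod S powr - (1 + \<delta>))"
    by (rule sum_distrib_left[symmetric])
  also have "\<dots> \<le> 2 * real H powr ((1 + \<delta>) / 2) * Z" using Z by (intro mult_left_mono) auto
  finally show ?thesis by (simp add: mult_ac)
qed

text \<open>The pointwise bound gives at most a constant times H^(1 + l(1+\<delta>)/2), and this
  exponent is at most l because l \<ge> 3 and \<delta> \<le> 1/3 imply l(1-\<delta>) \<ge>
  2.\<close>

lemma moment_trunc_bound_large_H:
  assumes HN: "N \<le> H" and l3: "l \<ge> 3"
  shows "\<bar>\<Sum>n\<in>{1..N}. D_trunc P k H n ^ l\<bar> \<le> (2 * Z) ^ l * (real H ^ l * y\<^sup>2)"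
proof -
  have H1: "real H \<ge> 1" using H_pos by simp
  have "\<bar>\<Sum>n\<in>{1..N}. D_trunc P k H n ^ l\<bar> \<le> (\<Sum>n\<in>{1..N}. \<bar>D_trunc P k H n\<bar> ^ l)"
    by (rule order_trans[OF sum_abs]) (simp add: power_abs)
  also have "\<dots> \<le> (\<Sum>n\<in>{1..N}. (2 * Z * real H powr ((1 + \<delta>) / 2)) ^ l)"
    using HN by (intro sum_mono power_mono D_trunc_le_sqrt) auto
  also have "\<dots> = (2 * Z) ^ l * (real N * real H powr (real l * ((1 + \<delta>) / 2)))"
    using H1 by (simp add: power_mult_distrib powr_power mult_ac)
  also have "\<dots> \<le> (2 * Z) ^ l * (real H ^ l * y\<^sup>2)"
  proof (intro mult_left_mono)
    have "real N * real H powr (real l * ((1 + \<delta>) / 2)) \<le> real H powr 1 * real H powr (real l * ((1 + \<delta>) / 2))"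
      using HN by (intro mult_right_mono) auto
    also have "\<dots> = real H powr (1 + real l * ((1 + \<delta>) / 2))" by (rule powr_add[symmetric])
    also have "\<dots> \<le> real H powr real l"
    proof (rule powr_mono)
      have "3 * (1 - 1 / 3) \<le> real l * (1 - \<delta>)" using l3 \<delta> by (intro mult_mono) auto
      then have "2 + \<delta> * real l \<le> real l" by (simp add: algebra_simps)
      then show "1 + real l * ((1 + \<delta>) / 2) \<le> real l" by (simp add: field_simps)
    qed (use H1 in auto)
    also have "\<dots> = real H ^ l * 1" using H1 by (simp add: powr_realpow)
    also have "\<dots> \<le> real H ^ l * y\<^sup>2" using y_ge_1 by (intro mult_left_mono one_le_power) auto
    finally show "real N * real H powr (real l * ((1 + \<delta>) / 2)) \<le> real H ^ l * y\<^sup>2" .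
  qed (use Z1 in auto)
  finally show ?thesis .
qed

end

section \<open>The Euler product and the limit over all primes\<close>

text \<open>If \<open>d ^ k\<close> divides \<open>n\<close> with \<open>d > 1\<close>, so does
  \<open>p ^ k\<close> for any prime \<open>p\<close> dividing \<open>d\<close>, and then
  \<open>p \<le> p ^ k\<close> and \<open>p ^ k \<le> n\<close>; hence the primes up to
  \<open>m\<close> detect every such power.\<close>

lemma mu_free_eq_prod:
  assumes "n \<ge> 1" "n \<le> m" "k \<ge> 1"
  shows "mu_free k n = (\<Prod>p\<in>{p. prime p \<and> p \<le> m}. 1 - of_bool (p ^ k dvd n))"
proof (cases "k_free k n")
  case True
  then have "\<not> p ^ k dvd n" if "prime p" for p using that prime_gt_1_nat[OF that] by (auto simp: k_free_def)
  then show ?thesis using True by (simp add: mu_free_def)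
next
  case False
  then obtain d where d: "d > 1" "d ^ k dvd n" using assms by (auto simp: k_free_def)
  obtain p where p: "prime p" "p dvd d" using d prime_factor_nat[of d] by auto
  have pn: "p ^ k dvd n" using p d dvd_power_same dvd_trans by blast
  then have "p ^ k \<le> n" using assms by (intro dvd_imp_le) auto
  moreover have "p \<le> p ^ k" using p prime_ge_1_nat assms by (intro self_le_power) auto
  ultimately have "p \<le> m" using assms by linarith
  then have "(\<Prod>p\<in>{p. prime p \<and> p \<le> m}. 1 - of_bool (p ^ k dvd n)) = (0::real)"
    using p pn by (intro prod_zero) auto
  then show ?thesis using False by (simp add: mu_free_def)
qed

lemma zeta_summable: "k \<ge> 2 \<Longrightarrow> summable (\<lambda>n. 1 / real (Suc n) ^ k)"
  using inverse_power_summable[of k, where ?'a = real] by (subst summable_Suc_iff) (simp add: field_simps)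

lemma zeta_has_sum:
  assumes "k \<ge> 2"
  shows "((\<lambda>n. 1 / real n ^ k) has_sum zeta_at k) {1..}"
proof -
  have "((\<lambda>n. 1 / real (Suc n) ^ k) has_sum zeta_at k) UNIV"
    unfolding zeta_at_def using zeta_summable[OF assms] summable_sums[OF zeta_summable[OF assms]]
    by (intro norm_summable_imp_has_sum) auto
  then have "(((\<lambda>n. 1 / real n ^ k) \<circ> Suc) has_sum zeta_at k) UNIV" by (simp add: o_def)
  then have "((\<lambda>n. 1 / real n ^ k) has_sum zeta_at k) (range Suc)"
    by (subst has_sum_reindex) auto
  moreover have "range Suc = {1..}" by (auto simp: image_iff Suc_le_eq gr0_conv_Suc)
  ultimately show ?thesis by simp
qed

text \<open>Sieving by a further prime \<open>p\<close> removes from the remaining set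
  \<open>A\<close> its multiples of \<open>p\<close>. These form the dilate of \<open>A\<close> by
  \<open>p\<close>, which carries the share \<open>1 / real p ^ k\<close> of the sum.\<close>

lemma sieved_zeta_has_sum:
  assumes k: "k \<ge> 2" and P: "finite P" "\<And>p. p \<in> P \<Longrightarrow> prime p"
  shows "((\<lambda>n. 1 / real n ^ k) has_sum zeta_at k * (\<Prod>p\<in>P. 1 - 1 / real p ^ k)) {n. n \<ge> 1 \<and> (\<forall>p\<in>P. \<not> p dvd n)}"
  using P
proof (induction P rule: finite_induct)
  case empty
  have "{n::nat. n \<ge> 1 \<and> (\<forall>p\<in>{}. \<not> p dvd n)} = {1..}" by auto
  then show ?case using zeta_has_sum[OF k] by simp
next
  case (insert p P)
  define A where "A = {n. n \<ge> 1 \<and> (\<forall>p\<in>P. \<not> p dvd n)}"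
  define S where "S = zeta_at k * (\<Prod>p\<in>P. 1 - 1 / real p ^ k)"
  have A: "((\<lambda>n. 1 / real n ^ k) has_sum S) A" using insert unfolding A_def S_def by auto
  have p: "prime p" "p > 0" using insert.prems prime_gt_0_nat by auto
  have "((\<lambda>n. 1 / real p ^ k * (1 / real n ^ k)) has_sum 1 / real p ^ k * S) A"
    by (rule has_sum_cmult_right[OF A])
  then have "(((\<lambda>n. 1 / real n ^ k) \<circ> (*) p) has_sum 1 / real p ^ k * S) A"
    by (simp add: o_def power_mult_distrib)
  then have B: "((\<lambda>n. 1 / real n ^ k) has_sum 1 / real p ^ k * S) ((*) p ` A)"
    using p by (subst has_sum_reindex) (auto intro: inj_onI)
  have np: "\<not> q dvd p" if "q \<in> P" for q
    using insert.hyps insert.prems that p primes_dvd_imp_eq by (metis insertCI)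
  \<comment> \<open>Multiplication by \<open>p\<close> introduces no prime of \<open>P\<close>,
    since \<open>p\<close> is not in \<open>P\<close>.\<close>
  have sub: "(*) p ` A \<subseteq> A" 
    using p np insert.prems by (auto simp: A_def prime_dvd_mult_iff)
  have eq: "A - (*) p ` A = {n. n \<ge> 1 \<and> (\<forall>q\<in>insert p P. \<not> q dvd n)}"
  proof (intro equalityI subsetI)
    fix n assume n: "n \<in> A - (*) p ` A"
    have "\<not> p dvd n"
    proof
      assume "p dvd n"
      then obtain m where m: "n = p * m" by blast
      then have "m \<in> A" using n by (auto simp: A_def)
      then show False using n m by auto
    qed
    then show "n \<in> {n. n \<ge> 1 \<and> (\<forall>q\<in>insert p P. \<not> q dvd n)}" using n by (auto simp: A_def)
  qed (auto simp: A_def)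
  have "((\<lambda>n. 1 / real n ^ k) has_sum S - 1 / real p ^ k * S) (A - (*) p ` A)"
    by (rule has_sum_Diff[OF A B sub])
  moreover have "S - 1 / real p ^ k * S = zeta_at k * (\<Prod>p\<in>insert p P. 1 - 1 / real p ^ k)"
    using insert.hyps by (simp add: S_def algebra_simps)
  ultimately show ?case unfolding eq by simp
qed

text \<open>An integer above 1 without prime factors up to \<open>m\<close> exceeds
  \<open>m\<close>, so sieving leaves only 1 and part of the tail of the zeta series, which tends to
  0.\<close>

lemma euler_product_zeta:
  assumes k: "k \<ge> 2"
  shows "(\<lambda>m. \<Prod>p\<in>{p. prime p \<and> p \<le> m}. 1 - 1 / real p ^ k) \<longlonglongrightarrow> inverse (zeta_at k)"
proof -
  let ?f = "\<lambda>n::nat. 1 / real n ^ k"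
  define E where "E = (\<lambda>m. \<Prod>p\<in>{p. prime p \<and> p \<le> m}. 1 - 1 / real p ^ k)"
  have bound: "\<bar>zeta_at k * E m - 1\<bar> \<le> zeta_at k - (\<Sum>n=1..m. ?f n)" for m
  proof -
    define A where "A = {n. n \<ge> 1 \<and> (\<forall>p\<in>{p. prime p \<and> p \<le> m}. \<not> p dvd n)}"
    have A: "(?f has_sum zeta_at k * E m) A"
      unfolding A_def E_def by (rule sieved_zeta_has_sum[OF k]) auto
    have "(?f has_sum (\<Sum>n\<in>{1}. ?f n)) {1}" by (rule has_sum_finite) auto
    then have "(?f has_sum 1) {1}" by simp
    then have A1: "(?f has_sum zeta_at k * E m - 1) (A - {1})"
      by (rule has_sum_Diff[OF A]) (auto simp: A_def)
    have "(?f has_sum (\<Sum>n=1..m. ?f n)) {1..m}" by (rule has_sum_finite) auto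
    then have T: "(?f has_sum zeta_at k - (\<Sum>n=1..m. ?f n)) ({1..} - {1..m})"
      by (rule has_sum_Diff[OF zeta_has_sum[OF k]]) auto
    have sub: "A - {1} \<subseteq> {1..} - {1..m}"
    proof
      fix n assume n: "n \<in> A - {1}"
      then have "n \<noteq> 1" "n \<ge> 1" by (auto simp: A_def)
      then obtain p where p: "prime p" "p dvd n" using prime_factor_nat by auto
      then have "p > m" using n by (auto simp: A_def)
      moreover have "p \<le> n" using p \<open>n \<ge> 1\<close> by (intro dvd_imp_le) auto
      ultimately show "n \<in> {1..} - {1..m}" using \<open>n \<ge> 1\<close> by auto
    qed
    have "zeta_at k * E m - 1 \<le> zeta_at k - (\<Sum>n=1..m. ?f n)"
      by (rule has_sum_mono2[OF A1 T sub]) auto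
    moreover have "0 \<le> zeta_at k * E m - 1" by (rule has_sum_nonneg[OF A1]) auto
    ultimately show ?thesis by simp
  qed
  have "(\<lambda>m. \<Sum>n<m. 1 / real (Suc n) ^ k) \<longlonglongrightarrow> zeta_at k"
    unfolding zeta_at_def by (rule summable_LIMSEQ[OF zeta_summable[OF k]])
  moreover have "(\<Sum>n<m. 1 / real (Suc n) ^ k) = (\<Sum>n=1..m. ?f n)" for m
    by (rule sum.reindex_bij_witness[of _ "\<lambda>n. n - 1" Suc]) auto
  ultimately have "(\<lambda>m. \<Sum>n=1..m. ?f n) \<longlonglongrightarrow> zeta_at k" by simp
  then have "(\<lambda>m. zeta_at k - (\<Sum>n=1..m. ?f n)) \<longlonglongrightarrow> zeta_at k - zeta_at k" by (intro tendsto_intros)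
  then have "(\<lambda>m. zeta_at k - (\<Sum>n=1..m. ?f n)) \<longlonglongrightarrow> 0" by simp
  then have "(\<lambda>m. zeta_at k * E m - 1) \<longlonglongrightarrow> 0"
    by (rule Lim_null_comparison[rotated]) (intro always_eventually allI, simp only: real_norm_def bound)
  then have "(\<lambda>m. zeta_at k * E m - 1 + 1) \<longlonglongrightarrow> 0 + 1" by (intro tendsto_intros)
  then have lim: "(\<lambda>m. zeta_at k * E m) \<longlonglongrightarrow> 1" by simp
  have "zeta_at k \<noteq> 0"
  proof
    assume "zeta_at k = 0"
    then have "(\<lambda>m::nat. 0::real) \<longlonglongrightarrow> 1" using lim by simp
    then show False by (simp add: LIMSEQ_const_iff)
  qed
  then have "(\<lambda>m. inverse (zeta_at k) * (zeta_at k * E m)) = E" by (auto simp: fun_eq_iff)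
  moreover have "(\<lambda>m. inverse (zeta_at k) * (zeta_at k * E m)) \<longlonglongrightarrow> inverse (zeta_at k) * 1"
    using lim by (intro tendsto_intros)
  ultimately show ?thesis by (simp add: E_def)
qed

text \<open>For fixed \<open>n\<close> the sieved count is constant once
  \<open>m \<ge> n + H\<close>, so only the main term has a genuine limit.\<close>

lemma D_trunc_tendsto:
  assumes k: "k \<ge> 2" and n: "n \<ge> 1"
  shows "(\<lambda>m. D_trunc {p. prime p \<and> p \<le> m} k H n) \<longlonglongrightarrow> D_free k n H"
proof -
  have "(\<lambda>m. \<Sum>h<H. \<Prod>p\<in>{p. prime p \<and> p \<le> m}. 1 - of_bool (p ^ k dvd n + h)) \<longlonglongrightarrow> N_free k n H"
  proof (rule tendsto_eventually, rule eventually_sequentiallyI[of "n + H"])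
    fix m assume "m \<ge> n + H"
    then show "(\<Sum>h<H. \<Prod>p\<in>{p. prime p \<and> p \<le> m}. 1 - of_bool (p ^ k dvd n + h)) = N_free k n H"
      unfolding N_free_def using n k by (intro sum.cong refl mu_free_eq_prod[symmetric]) auto
  qed
  moreover have "(\<lambda>m. real H * (\<Prod>p\<in>{p. prime p \<and> p \<le> m}. 1 - 1 / real p ^ k)) \<longlonglongrightarrow> real H * inverse (zeta_at k)"
    by (intro tendsto_intros euler_product_zeta k)
  ultimately show ?thesis unfolding D_trunc_def D_free_def mult.commute[of "inverse _"] by (rule tendsto_diff)
qed

text \<open>The constants \<open>C\<close>, \<open>Z\<close> and \<open>K\<close> are fixed before
  the bound \<open>m\<close> on the primes, so the estimate for the truncated deviations survives
  the limit as \<open>m\<close> grows.\<close>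

lemma moment_bound:
  fixes k l :: nat and \<epsilon> :: real
  assumes k: "k \<ge> 2" and l: "l \<ge> 3" and \<epsilon>: "\<epsilon> > 0"
  obtains C where "C \<ge> 0" "\<And>x H. x \<ge> 1 \<Longrightarrow> H \<ge> 1 \<Longrightarrow>
            \<bar>moment k x H l\<bar> \<le> C * (x powr \<epsilon> *
              (real H powr (real l / (2 * real k)) * x + real H ^ l * x powr (2 / (real k + 1))))"
proof -
  \<comment> \<open>The value 1/3 is the limit set by \<open>bounded_family\<close>; the other entry
    makes N^((l+4)\<delta>) at most x^\<epsilon>.\<close>
  define \<delta> where "\<delta> = min (1 / 3) (\<epsilon> / (real l + 4))"
  have \<delta>: "0 < \<delta>" "\<delta> \<le> 1 / 3"
    unfolding \<delta>_def using \<epsilon> by (simp, intro min.cobounded1)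
  have "\<delta> \<le> \<epsilon> / (real l + 4)" by (simp add: \<delta>_def)
  then have \<delta>\<epsilon>: "(real l + 4) * \<delta> \<le> \<epsilon>" by (simp add: field_simps)
  obtain C where C: "C \<ge> 1" "\<And>U. finite U \<Longrightarrow> (\<And>p. p \<in> U \<Longrightarrow> prime p) \<Longrightarrow> (4 ^ l) ^ card U \<le> C * rprod U powr \<delta>"
    using power_card_primes_le[of "4 ^ l" \<delta>] \<delta> by (metis one_le_numeral one_le_power)
  obtain Z where Z: "Z \<ge> 1" "\<And>P. finite P \<Longrightarrow> (\<And>p. p \<in> P \<Longrightarrow> prime p) \<Longrightarrow> (\<Sum>U\<in>Pow P. rprod U powr - (1 + \<delta>)) \<le> Z"
    using sum_rprod_powr_le[OF \<delta>(1)] by metis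
  define K1 where "K1 = 2 ^ l * C * Z + (2 * real l + 2 * C) * Z * Z ^ l * (2 * C) ^ l + 2 * C * Z * Z ^ l"
  define K where "K = K1 + (2 * Z) ^ l"
  have K1: "K1 \<ge> 0" using C Z by (simp add: K1_def)
  have K: "K \<ge> K1" "K \<ge> (2 * Z) ^ l" "K \<ge> 0" using K1 Z by (auto simp: K_def)
  show thesis
  proof (rule that[OF K(3)])
    fix x :: real and H :: nat assume x: "x \<ge> 1" and H: "H \<ge> 1"
    define N where "N = nat \<lfloor>x\<rfloor>"
    have N: "N \<ge> 1" "real N \<le> x" using x by (auto simp: N_def le_nat_floor)
    have set: "{n. 0 < n \<and> real n \<le> x} = {1..N}"
      using x by (auto simp: N_def le_nat_floor Suc_le_eq) linarith
    define a where "a = real H powr (real l / (2 * real k))"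
    define b where "b = real H ^ l"
    have ab: "a \<ge> 0" "b \<ge> 0" by (auto simp: a_def b_def)
    define R where "R = x powr \<epsilon> * (a * x + b * x powr (2 / (real k + 1)))"
    have bound: "\<bar>\<Sum>n\<in>{1..N}. D_trunc {p. prime p \<and> p \<le> m} k H n ^ l\<bar> \<le> K * R" for m
    proof -
      interpret bounded_family "{p. prime p \<and> p \<le> m}" k H l N \<delta> C Z
      proof
        show "(4 ^ l) ^ card U \<le> C * rprod U powr \<delta>" if "U \<subseteq> {p. prime p \<and> p \<le> m}" for U
          using that by (intro C(2)) (auto intro: finite_subset[of _ "{..m}"])
      qed (use k l H N \<delta> C(1) Z in auto)
      have y2: "y\<^sup>2 \<le> x powr (2 / (real k + 1))"
      proof -
        have "y\<^sup>2 = y powr 2" using y_ge_1 by (simp add: powr_numeral)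
        also have "\<dots> = real N powr (2 / (real k + 1))" unfolding y_def by (simp add: powr_powr)
        also have "\<dots> \<le> x powr (2 / (real k + 1))" using N by (intro powr_mono2) auto
        finally show ?thesis .
      qed
      have ble: "b * y\<^sup>2 \<le> b * x powr (2 / (real k + 1))" using y2 ab by (intro mult_left_mono)
      show ?thesis
      \<comment> \<open>For \<open>H \<le> N\<close> the expansion into tuples applies; beyond that
        the pointwise bound is good enough.\<close>
      proof (cases "H \<le> N")
        case True
        have "real N powr ((real l + 4) * \<delta>) \<le> x powr ((real l + 4) * \<delta>)" using N \<delta> by (intro powr_mono2) auto
        also have "\<dots> \<le> x powr \<epsilon>" using x \<delta>\<epsilon> by (intro powr_mono)
        finally have V: "real N powr ((real l + 4) * \<delta>) \<le> x powr \<epsilon>" .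
        have "\<bar>\<Sum>n\<in>{1..N}. D_trunc {p. prime p \<and> p \<le> m} k H n ^ l\<bar> \<le> K1 * (real N powr ((real l + 4) * \<delta>) * (a * real N + b * y\<^sup>2))"
          unfolding K1_def a_def b_def by (rule moment_trunc_bound[OF True])
        also have "\<dots> \<le> K * R"
          unfolding R_def using K K1 V N ab y2 ble x by (intro mult_mono add_mono mult_left_mono) auto
        finally show ?thesis .
      next
        case False
        have x1: "1 \<le> x powr \<epsilon>" using x \<epsilon> by (intro ge_one_powr_ge_zero) auto
        \<comment> \<open>The factor 1 and the summand 0 stand in for
          \<open>x powr \<epsilon>\<close> and the first term of \<open>R\<close>, so that the
          comparison goes term by term.\<close>
        have "\<bar>\<Sum>n\<in>{1..N}. D_trunc {p. prime p \<and> p \<le> m} k H n ^ l\<bar> \<le> (2 * Z) ^ l * (1 * (0 + b * y\<^sup>2))"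
          using moment_trunc_bound_large_H False l by (simp add: b_def)
        also have "\<dots> \<le> K * R"
          unfolding R_def using K Z x1 ab y2 ble x by (intro mult_mono add_mono) auto
        finally show ?thesis .
      qed
    qed
    have "(\<lambda>m. \<Sum>n\<in>{1..N}. D_trunc {p. prime p \<and> p \<le> m} k H n ^ l) \<longlonglongrightarrow> (\<Sum>n\<in>{1..N}. D_free k n H ^ l)"
      by (intro tendsto_sum tendsto_power D_trunc_tendsto k) auto
    then have "(\<lambda>m. \<bar>\<Sum>n\<in>{1..N}. D_trunc {p. prime p \<and> p \<le> m} k H n ^ l\<bar>) \<longlonglongrightarrow> \<bar>\<Sum>n\<in>{1..N}. D_free k n H ^ l\<bar>"
      by (rule tendsto_rabs)
    then have "\<bar>\<Sum>n\<in>{1..N}. D_free k n H ^ l\<bar> \<le> K * R"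
      by (rule LIMSEQ_le_const2) (use bound in auto)
    then show "\<bar>moment k x H l\<bar> \<le> K * (x powr \<epsilon> * (real H powr (real l / (2 * real k)) * x + real H ^ l * x powr (2 / (real k + 1))))"
      unfolding moment_def set R_def a_def b_def .
  qed
qed

theorem theorem1p1:
  fixes k l :: nat and \<epsilon> :: real
  assumes "k \<ge> 2" and "l \<ge> 3" and "\<epsilon> > 0"
  shows "(\<exists>C::real. \<forall>(x::real) (H::nat). x \<ge> 1 \<longrightarrow> H \<ge> 1 \<longrightarrow>
            \<bar>moment k x H l\<bar> \<le> C * (x powr \<epsilon> *
              (real H powr (real l / (2 * real k)) * x + real H ^ l * x powr (2 / (real k + 1)))))
       \<and> (\<exists>C::real. \<forall>(x::real) (H::nat). x \<ge> 1 \<longrightarrow> H \<ge> 1 \<longrightarrow>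
            real H \<le> x powr (c_exp k / real l) \<longrightarrow>
            \<bar>moment k x H l\<bar> \<le> C * (x powr (1 + \<epsilon>) * real H powr (real l / (2 * real k))))"
proof -
  obtain C where C: "C \<ge> 0" "\<And>x H. x \<ge> 1 \<Longrightarrow> H \<ge> 1 \<Longrightarrow>
            \<bar>moment k x H l\<bar> \<le> C * (x powr \<epsilon> *
              (real H powr (real l / (2 * real k)) * x + real H ^ l * x powr (2 / (real k + 1))))"
    using moment_bound[OF assms] by blast
  have "\<bar>moment k x H l\<bar> \<le> 2 * C * (x powr (1 + \<epsilon>) * real H powr (real l / (2 * real k)))"
    if x: "x \<ge> 1" and H: "H \<ge> 1" and Hx: "real H \<le> x powr (c_exp k / real l)" for x :: real and H :: nat
  proof -
    \<comment> \<open>With this exponent H^l = H^(l/2k) H^e, so a bound for H^e compares the second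
      term of the general estimate with the first.\<close>
    define e where "e = real l - real l / (2 * real k)"
    have kk: "real k \<ge> 2" using assms by simp
    have e: "e = real l * (2 * real k - 1) / (2 * real k)" using kk by (simp add: e_def field_simps)
    have e0: "e \<ge> 0" using kk by (simp add: e)
    have "real H powr e \<le> (x powr (c_exp k / real l)) powr e" using Hx e0 by (intro powr_mono2) auto
    also have "\<dots> = x powr (1 - 2 / (real k + 1))"
    proof -
      \<comment> \<open>The value of c_k is exactly the one that turns the range of \<open>H\<close>
        into H^e \<le> x^(1 - 2/(k+1)).\<close>
      have "c_exp k / real l * e = 1 - 2 / (real k + 1)"
        using kk assms(2) by (simp add: e c_exp_def divide_simps)
      then show ?thesis by (simp add: powr_powr)
    qed
    finally have He: "real H powr e \<le> x powr (1 - 2 / (real k + 1))" .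
    have "real H ^ l * x powr (2 / (real k + 1)) = real H powr (real l / (2 * real k)) * (real H powr e * x powr (2 / (real k + 1)))"
      using H by (simp add: e_def powr_realpow[symmetric] mult.assoc[symmetric] powr_add[symmetric])
    also have "\<dots> \<le> real H powr (real l / (2 * real k)) * (x powr (1 - 2 / (real k + 1)) * x powr (2 / (real k + 1)))"
      using He by (intro mult_left_mono mult_right_mono) auto
    also have "\<dots> = real H powr (real l / (2 * real k)) * x" using x by (simp flip: powr_add)
    finally have le: "real H ^ l * x powr (2 / (real k + 1)) \<le> real H powr (real l / (2 * real k)) * x" .
    have "\<bar>moment k x H l\<bar> \<le> C * (x powr \<epsilon> * (real H powr (real l / (2 * real k)) * x + real H ^ l * x powr (2 / (real k + 1))))"
      by (rule C(2)[OF x H])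
    also have "\<dots> \<le> C * (x powr \<epsilon> * (real H powr (real l / (2 * real k)) * x + real H powr (real l / (2 * real k)) * x))"
      using C(1) le by (intro mult_left_mono add_left_mono) auto
    also have "\<dots> = 2 * C * (x powr (1 + \<epsilon>) * real H powr (real l / (2 * real k)))"
      using x by (simp add: powr_add)
    finally show ?thesis .
  qed
  then show ?thesis using C by blast
qed

end
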